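(* Let $\omega := 2\log\frac{\sqrt5+1}{2}$ and, for $n\ge1$, let $$a_n' := \frac{2n+1}{\sqrt5\,\omega}-\frac25,\qquad b_n' := \left(\frac{1}{5\omega^2}-\frac{2}{5\sqrt5\,\omega}\right)(2n+1)-\frac{2}{25},$$ $$c_n' := \frac{2\sqrt n}{(5\sqrt{b_n'}\,\omega)^3}\Big\{\big(2\sqrt5\,\omega^2-30\omega+10\sqrt5\big)\,n+3\omega^3+\sqrt5\,\omega^2-15\omega+5\sqrt5\Big\}.$$ Then $$\frac{\sqrt{5b_n'}\,(2j)!\,\omega^{2n+1}}{2\,(2n)!}\left\{ {n \atop j}\right\}_{1/2} = \frac{1}{\sqrt{2\pi}}\,e^{-x^2/2}\left(1+\frac{c_n'\,(x^3-3x)}{6\sqrt n}\right)+o\left(\frac1{\sqrt n}\right)$$ as $n\to\infty$, uniformly in $j\in\mathbb{Z}$, where $x=(j-a_n')/\sqrt{b_n'}$.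
   Context: The Chebyshev-Stirling numbers of the second kind $\left\{ {n \atop j}\right\}_{1/2}$, for non-negative integers $n,j$, are defined by $\left\{ {n \atop j}\right\}_{1/2}=\left\{ {n-1 \atop j-1}\right\}_{1/2}+j^2\left\{ {n-1 \atop j}\right\}_{1/2}$ for $n,j\ge1$, with $\left\{ {n \atop 0}\right\}_{1/2}=\delta_{n,0}$ and $\left\{ {0 \atop j}\right\}_{1/2}=\delta_{0,j}$ (Kronecker delta). In particular $\left\{ {n \atop j}\right\}_{1/2}=0$ for $j>n$. For negative integers $j$ the product $(2j)!\left\{ {n \atop j}\right\}_{1/2}$ is understood to be $0$. Here $\log$ is the natural logarithm. Uniformity in $j\in\mathbb{Z}$ means that the supremum over $j\in\mathbb{Z}$ of the absolute value of the error term, multiplied by $\sqrt n$, tends to $0$ as $n\to\infty$. *)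

theory Defs
  imports "HOL-Analysis.Analysis"
begin

fun cheb_stirling :: "nat \<Rightarrow> nat \<Rightarrow> nat" where
  "cheb_stirling 0 0 = 1"
| "cheb_stirling 0 (Suc j) = 0"
| "cheb_stirling (Suc n) 0 = 0"
| "cheb_stirling (Suc n) (Suc j) = cheb_stirling n j + (Suc j)^2 * cheb_stirling n (Suc j)"

text \<open>The product \<open>(2j)! {n, j}\<close> for integer \<open>j\<close>, with the convention that it
  vanishes for negative \<open>j\<close>.\<close>

definition fact_cheb_stirling :: "nat \<Rightarrow> int \<Rightarrow> real" where
  "fact_cheb_stirling n j =
     (if j < 0 then 0 else fact (2 * nat j) * real (cheb_stirling n (nat j)))"

definition omega :: real where
  "omega = 2 * ln ((sqrt 5 + 1) / 2)"

definition a' :: "nat \<Rightarrow> real" where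
  "a' n = (2 * real n + 1) / (sqrt 5 * omega) - 2 / 5"

definition b' :: "nat \<Rightarrow> real" where
  "b' n = (1 / (5 * omega^2) - 2 / (5 * sqrt 5 * omega)) * (2 * real n + 1) - 2 / 25"

definition c' :: "nat \<Rightarrow> real" where
  "c' n = 2 * sqrt (real n) / (5 * sqrt (b' n) * omega)^3 *
     ((2 * sqrt 5 * omega^2 - 30 * omega + 10 * sqrt 5) * real n
       + 3 * omega^3 + sqrt 5 * omega^2 - 15 * omega + 5 * sqrt 5)"

definition x_std :: "nat \<Rightarrow> int \<Rightarrow> real" where
  "x_std n j = (real_of_int j - a' n) / sqrt (b' n)"

definition lhs_term :: "nat \<Rightarrow> int \<Rightarrow> real" where
  "lhs_term n j =
     sqrt (5 * b' n) * omega^(2 * n + 1) / (2 * fact (2 * n)) * fact_cheb_stirling n j"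

definition edgeworth_term :: "nat \<Rightarrow> int \<Rightarrow> real" where
  "edgeworth_term n j = (let x = x_std n j in
     1 / sqrt (2 * pi) * exp (- (x^2) / 2) * (1 + c' n * (x^3 - 3 * x) / (6 * sqrt (real n))))"

end

theory Submission
  imports Defs "HOL-Complex_Analysis.Complex_Analysis" "HOL-Probability.Characteristic_Functions"
    "HOL-Real_Asymp.Real_Asymp"
begin

text \<open>Put \<open>C(x) = 2 cosh x - 2\<close>. The powers of \<open>C\<close> satisfy a second order differential equation that
  turns into the recurrence of the Chebyshev-Stirling numbers, so \<open>(2j)! {n, j} / (2n)!\<close> is the
  coefficient of \<open>x^(2n)\<close> in \<open>C(x)^j\<close>. Consequently the sum of these numbers over \<open>j\<close>, weighted by
  \<open>z^j\<close>, is the coefficient \<open>f_n(z)\<close> of \<open>x^(2n)\<close> in \<open>1 / (1 - z C(x))\<close>. For a fixed \<open>n\<close> the values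
  \<open>f_n(exp(i t))\<close> with \<open>-pi \<le> t \<le> pi\<close> determine every summand by Fourier inversion, and this is where
  the uniformity in \<open>j\<close> comes from: an \<open>L^1\<close> estimate of functions of \<open>t\<close> bounds all \<open>j\<close> at once.

  Write \<open>z = exp \<tau>\<close>. The zeros of \<open>1 - z C(x)\<close> of smallest modulus are \<open>w\<close> and \<open>-w\<close>, where
  \<open>sinh (w/2) = exp(-\<tau>/2) / 2\<close>, and for all \<open>z\<close> on the unit circle the other zeros stay outside
  the disc of radius 3. The two poles contribute \<open>2v / (s w^(2n+1))\<close> to \<open>f_n(z)\<close>, with
  \<open>v = sinh (w/2)\<close> and \<open>s = cosh (w/2)\<close>, and the remainder is \<open>O(9^(-n))\<close> uniformly in \<open>z\<close>
  (\<open>geometric_fps_nth_asymptotics\<close>). At \<open>z = 1\<close> one has \<open>w = \<omega>\<close>.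

  Divided by its value at \<open>\<tau> = 0\<close>, the main term is the exponential of
  \<open>(2n+1) (log \<omega> - log w) - \<tau>/2 - log s + const\<close>. The first three derivatives of this function at
  \<open>\<tau> = 0\<close> are exactly \<open>a'\<close>, \<open>b'\<close> and a number \<open>\<kappa>\<close> with \<open>c' = sqrt n \<kappa> / b'^(3/2)\<close>, and the fourth
  derivative is \<open>O(n)\<close> on the whole segment \<open>\<tau> = i t\<close>, \<open>-pi \<le> t \<le> pi\<close> (\<open>log_residue_Taylor\<close>).
  Moreover \<open>|w| \<ge> \<omega> exp (c t^2)\<close> on this segment (\<open>norm_pole_gaussian_lower_bound\<close>), so the main term has
  Gaussian decay over the whole period, not only near \<open>t = 0\<close>.

  On the other side, \<open>exp (-b' t^2 / 2) (1 + \<kappa> (i t)^3 / 6)\<close> is the Fourier transform of the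
  Edgeworth density centred at its mean \<open>a'\<close> (\<open>gaussian_edgeworth_fourier\<close>). The difference of the two transforms is at most
  a constant times \<open>(n^2 t^6 + n t^4) exp (-c n t^2)\<close>, plus \<open>O(9^(-n))\<close> on the period (\<open>norm_Fourier_error_le\<close>). Its integral is
  \<open>O(n^(-3/2))\<close>, and the factor \<open>sqrt b'\<close> turns this into an error \<open>O(1/n)\<close>, uniformly in \<open>j\<close>, which is
  stronger than the error term claimed.\<close>

section \<open>Central factorial numbers as power series coefficients\<close>

text \<open>The power series of \<open>2 cosh x - 2 = (2 sinh (x/2))\<^sup>2\<close>.\<close>

definition versine_fps :: "complex fps" where
  "versine_fps = fps_exp 1 + fps_exp (- 1) - 2"

lemma fps_const_neg_1: "fps_const (- 1 :: 'a :: comm_ring_1) = - 1"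
  by (metis fps_const_1_eq_1 fps_const_neg)

lemma versine_fps_deriv_square:
  "(fps_deriv versine_fps)^2 = versine_fps^2 + 4 * versine_fps"
proof -
  have E: "fps_exp 1 * fps_exp (- 1 :: complex) = 1"
    using fps_exp_add_mult[of "1::complex" "-1"] by simp
  have "(fps_exp 1 - fps_exp (- 1 :: complex))^2
      = (fps_exp 1 + fps_exp (- 1) - 2)^2 + 4 * (fps_exp 1 + fps_exp (- 1) - 2)
        + 4 * (1 - fps_exp 1 * fps_exp (- 1 :: complex))"
    by (simp add: power2_eq_square algebra_simps)
  then show ?thesis
    by (simp add: versine_fps_def E fps_const_neg_1)
qed

lemma versine_fps_deriv2: "fps_deriv (fps_deriv versine_fps) = versine_fps + 2"
  by (simp add: versine_fps_def)

text \<open>Since \<open>C'\<^sup>2 = C\<^sup>2 + 4C\<close> and \<open>C'' = C + 2\<close>, the second derivative of \<open>C^j\<close> is the combination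
  \<open>j\<^sup>2 C^j + 2j(2j-1) C^(j-1)\<close>. Its coefficients are those of the recurrence for \<open>(2j)! {n, j}\<close>.\<close>

lemma versine_fps_power_deriv2:
  "fps_deriv (fps_deriv (versine_fps ^ Suc j))
     = of_nat ((Suc j)^2) * versine_fps ^ Suc j + of_nat (2 * Suc j * (2 * j + 1)) * versine_fps ^ j"
proof (cases j)
  case 0
  then show ?thesis by (simp add: versine_fps_deriv2)
next
  case (Suc k)
  have power: "fps_deriv (F ^ Suc m) = of_nat (Suc m) * (F ^ m * fps_deriv F)" for F :: "complex fps" and m
    by (subst fps_deriv_power) (simp add: fps_of_nat mult_ac del: of_nat_Suc power_Suc)
  have scale: "fps_deriv (of_nat m * F) = of_nat m * fps_deriv F" for F :: "complex fps" and m
    by (simp add: fps_of_nat [symmetric])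
  have "fps_deriv (fps_deriv (versine_fps ^ Suc j))
      = of_nat (Suc j) * (of_nat j * versine_fps ^ k * (fps_deriv versine_fps)^2
          + versine_fps ^ j * fps_deriv (fps_deriv versine_fps))"
    unfolding power scale fps_deriv_mult Suc by (simp add: power2_eq_square algebra_simps)
  also have "\<dots> = of_nat (Suc j) * (of_nat j * versine_fps ^ k * (versine_fps^2 + 4 * versine_fps)
          + versine_fps ^ j * (versine_fps + 2))"
    by (simp only: versine_fps_deriv_square versine_fps_deriv2)
  also have "\<dots> = of_nat ((Suc j)^2) * versine_fps ^ Suc j + of_nat (2 * Suc j * (2 * j + 1)) * versine_fps ^ j"
    unfolding Suc by (simp add: power2_eq_square algebra_simps)
  finally show ?thesis .
qed

lemma cheb_stirling_conv_fps_nth: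
  "fps_nth (versine_fps ^ j) (2 * n) = of_real (fact (2 * j) * real (cheb_stirling n j) / fact (2 * n))"
proof (induction n arbitrary: j)
  case 0
  show ?case
    by (cases j) (simp_all add: versine_fps_def)
next
  case (Suc n)
  show ?case
  proof (cases j)
    case 0
    then show ?thesis by simp
  next
    case (Suc i)
    define N where "N = (of_nat (2 * n + 1) * of_nat (2 * n + 2) :: complex)"
    have N0: "N \<noteq> 0"
      unfolding N_def of_nat_mult[symmetric] of_nat_eq_0_iff by simp
    have "N * fps_nth (versine_fps ^ Suc i) (2 * Suc n) = fps_nth (fps_deriv (fps_deriv (versine_fps ^ Suc i))) (2 * n)"
      by (simp add: N_def algebra_simps del: power_Suc)
    also have "\<dots> = of_nat ((Suc i)^2) * fps_nth (versine_fps ^ Suc i) (2 * n)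
        + of_nat (2 * Suc i * (2 * i + 1)) * fps_nth (versine_fps ^ i) (2 * n)"
      unfolding versine_fps_power_deriv2
      by (simp del: of_nat_mult of_nat_power of_nat_Suc power_Suc add: fps_of_nat[symmetric])
    also have "\<dots> = of_real ((real ((Suc i)^2) * fact (2 * Suc i) * real (cheb_stirling n (Suc i))
        + fact (2 * Suc i) * real (cheb_stirling n i)) / fact (2 * n))"
      unfolding Suc.IH
      by (simp add: field_simps)
    also have "\<dots> = N * of_real (fact (2 * Suc i) * real (cheb_stirling (Suc n) (Suc i)) / fact (2 * Suc n))"
    proof -
      define M where "M = real (2*n+1) * real (2*n+2)"
      have M0: "M \<noteq> 0" unfolding M_def by (simp only: mult_eq_0_iff of_nat_eq_0_iff) simp
      have F: "fact (2 * Suc n) = M * fact (2 * n)"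
        by (simp add: M_def algebra_simps)
      have N': "N = of_real M" by (simp add: N_def M_def)
      have T: "real (cheb_stirling (Suc n) (Suc i))
          = real (cheb_stirling n i) + real ((Suc i)^2) * real (cheb_stirling n (Suc i))"
        by (simp only: cheb_stirling.simps of_nat_add of_nat_mult)
      have "(real ((Suc i)^2) * fact (2 * Suc i) * real (cheb_stirling n (Suc i))
          + fact (2 * Suc i) * real (cheb_stirling n i)) / fact (2 * n)
        = M * (fact (2 * Suc i) * real (cheb_stirling (Suc n) (Suc i)) / fact (2 * Suc n))"
        unfolding F T using M0 by (simp add: field_simps del: fact_Suc mult_Suc_right)
      thus ?thesis by (simp only: N' of_real_mult)
    qed
    finally show ?thesis using N0 Suc by (simp only: mult_left_cancel simp_thms)
  qed
qed

lemma versine_fps_nth_0 [simp]: "fps_nth versine_fps 0 = 0"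
  by (simp add: versine_fps_def)

lemma cheb_stirling_eq_0: "n < j \<Longrightarrow> cheb_stirling n j = 0"
  by (induction n j rule: cheb_stirling.induct) auto

text \<open>The series \<open>C\<close> starts with \<open>x\<^sup>2\<close>, so only \<open>C^j\<close> with \<open>j \<le> n\<close> contributes to the coefficient
  of \<open>x^(2n)\<close>, and the geometric series may be truncated.\<close>

lemma geometric_fps_nth:
  "fps_nth (inverse (1 - fps_const z * versine_fps)) (2 * n) = (\<Sum>j\<le>n. z ^ j * fps_nth (versine_fps ^ j) (2 * n))"
proof -
  define A where "A = fps_const z * versine_fps"
  define K where "K = inverse (1 - A)"
  have A0: "fps_nth A 0 = 0" by (simp add: A_def)
  have K: "(1 - A) * K = 1"
    unfolding K_def by (rule inverse_mult_eq_1') (simp add: A0)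
  have "(1 - A) * (\<Sum>j\<le>n. A ^ j) = 1 - A ^ Suc n"
    using sum_gp_basic[of A n] by simp
  hence "(1 - A) * K * (\<Sum>j\<le>n. A ^ j) = K - A ^ Suc n * K"
    by (metis (no_types, lifting) mult.assoc mult.commute mult.left_neutral left_diff_distrib)
  hence *: "K = (\<Sum>j\<le>n. A ^ j) + A ^ Suc n * K"
    by (simp add: K)
  have "fps_nth (A ^ Suc n * K) (2 * n) = 0"
  proof -
    have "fps_nth versine_fps 1 = 0"
      by (simp add: versine_fps_def fps_numeral_nth)
    then obtain B where B: "versine_fps = fps_X^2 * B"
    proof -
      have "versine_fps = fps_shift 2 versine_fps * fps_X ^ 2"
      proof (rule fps_ext)
        fix k :: nat
        have "fps_nth versine_fps k = 0" if "k < 2"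
          using that \<open>fps_nth versine_fps 1 = 0\<close> by (cases k) auto
        thus "fps_nth versine_fps k = fps_nth (fps_shift 2 versine_fps * fps_X ^ 2) k"
          by (cases "k < 2") (auto simp: fps_X_power_mult_right_nth not_less dest!: le_Suc_ex)
      qed
      thus ?thesis using that[of "fps_shift 2 versine_fps"] by (simp add: mult.commute)
    qed
    have "A ^ Suc n * K = fps_X ^ (2 * Suc n) * ((fps_const z * B) ^ Suc n * K)"
      unfolding A_def B power_mult
      by (simp only: power_mult_distrib mult_ac)
    thus ?thesis by (simp only: fps_X_power_mult_nth) simp
  qed
  hence "fps_nth K (2 * n) = fps_nth (\<Sum>j\<le>n. A ^ j) (2 * n)"
    by (subst *) simp
  thus ?thesis
    by (simp add: K_def A_def fps_sum_nth power_mult_distrib fps_const_power)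
qed

lemma versine_has_fps_expansion:
  "(\<lambda>x. 2 * cosh x - 2) has_fps_expansion versine_fps"
proof -
  have "(\<lambda>x::complex. exp x + exp (-x) - 2) has_fps_expansion versine_fps"
    unfolding versine_fps_def by (intro fps_expansion_intros)
  thus ?thesis by (simp add: cosh_field_def add_divide_distrib)
qed

section \<open>The dominant pole\<close>

lemma Re_sinh_complex: "Re (sinh z) = sinh (Re z) * cos (Im z)"
  by (simp add: sinh_field_def Re_exp field_simps)

lemma Im_sinh_complex: "Im (sinh z) = cosh (Re z) * sin (Im z)"
  by (simp add: sinh_field_def cosh_field_def Im_exp field_simps)

lemma cmod_sinh_squared: "(cmod (sinh z))^2 = (sinh (Re z))^2 + (sin (Im z))^2"
proof -
  have "(cmod (sinh z))^2 = (sinh (Re z))^2 * (cos (Im z))^2 + (cosh (Re z))^2 * (sin (Im z))^2"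
    by (simp add: cmod_power2 Re_sinh_complex Im_sinh_complex power_mult_distrib)
  also have "\<dots> = (sinh (Re z))^2 * ((sin (Im z))^2 + (cos (Im z))^2) + (sin (Im z))^2"
    by (simp only: cosh_square_eq distrib_left distrib_right mult_1_left add_ac)
  finally show ?thesis by simp
qed

text \<open>A crude substitute for Jordan's inequality, obtained from the cubic Taylor bound.\<close>

lemma abs_sin_ge_half: "\<bar>y\<bar> / 2 \<le> \<bar>sin y\<bar>" if "\<bar>y\<bar> \<le> pi / 2" for y :: real
proof -
  have "\<bar>sin y - (\<Sum>m<3. sin_coeff m * y ^ m)\<bar> \<le> inverse (fact 3) * \<bar>y\<bar> ^ 3"
    by (rule Maclaurin_sin_bound)
  hence "\<bar>sin y - y\<bar> \<le> \<bar>y\<bar> ^ 3 / 6"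
    by (simp add: eval_nat_numeral sin_coeff_def)
  moreover have "\<bar>y\<bar> ^ 3 / 6 \<le> \<bar>y\<bar> / 2"
  proof -
    have "\<bar>y\<bar> \<le> 17 / 10" using that pi_less_4 pi_approx by simp
    hence "\<bar>y\<bar>^2 \<le> (17/10)^2" by (intro power_mono) auto
    hence "\<bar>y\<bar> * \<bar>y\<bar>^2 \<le> \<bar>y\<bar> * 3" by (intro mult_left_mono) (auto simp: power2_eq_square)
    thus ?thesis by (simp add: power3_eq_cube power2_eq_square)
  qed
  ultimately show ?thesis by linarith
qed

lemma sqrt_5_less: "sqrt 5 < 9 / 4"
  by (rule real_less_lsqrt) (simp_all add: power2_eq_square)

lemma sqrt_5_gt: "2 < sqrt 5"
  by (rule real_less_rsqrt) (simp add: power2_eq_square)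

lemma omega_pos: "0 < omega"
  using sqrt_5_gt by (simp add: omega_def)

lemma omega_less_1: "omega < 1"
proof -
  have "(sqrt 5 + 1) / 2 < 1 + 1/2 + (1/2)^2 / (2::real)"
    using sqrt_5_less by (simp add: power2_eq_square)
  also have "\<dots> \<le> exp (1 / 2)" by (rule exp_lower_Taylor_quadratic) simp
  finally have "ln ((sqrt 5 + 1) / 2) < ln (exp (1/2))"
    using sqrt_5_gt by (subst ln_less_cancel_iff) auto
  thus ?thesis by (simp add: omega_def)
qed

text \<open>Equivalently \<open>2 cosh \<omega> - 2 = 1\<close>: the number \<open>\<omega>\<close> is the positive pole of \<open>1 / (1 - C(x))\<close>.\<close>

lemma sinh_half_omega: "sinh (omega / 2) = 1 / 2"
proof -
  have "sqrt 5 * sqrt 5 = (5::real)" by simp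
  moreover have "sinh (omega / 2) = ((sqrt 5 + 1) / 2 - inverse ((sqrt 5 + 1) / 2)) / 2"
    using sqrt_5_gt by (simp add: omega_def sinh_field_def exp_minus)
  ultimately show ?thesis using sqrt_5_gt by (simp add: field_simps)
qed

text \<open>The convex function \<open>sinh\<close> lies below its chord over the interval from \<open>0\<close> to \<open>\<omega>/2\<close>.\<close>

lemma abs_sinh_half_le_chord: "\<bar>sinh (a / 2)\<bar> \<le> \<bar>a\<bar> / (2 * omega)" if "\<bar>a\<bar> \<le> omega"
proof -
  have "convex_on {0..} (sinh :: real \<Rightarrow> real)"
    by (rule f''_ge0_imp_convex[where f' = cosh and f'' = sinh])
       (auto intro!: derivative_eq_intros)
  hence "sinh ((1 - \<bar>a\<bar> / omega) * 0 + \<bar>a\<bar> / omega * (omega / 2))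
       \<le> (1 - \<bar>a\<bar> / omega) * sinh 0 + \<bar>a\<bar> / omega * sinh (omega / 2)"
    using omega_pos that by (intro convex_onD[of "{0..}" sinh, unfolded real_scaleR_def]) auto
  hence "sinh (\<bar>a\<bar> / 2) \<le> \<bar>a\<bar> / (2 * omega)"
    using omega_pos by (simp add: sinh_half_omega)
  moreover have "\<bar>sinh (a / 2)\<bar> = sinh (\<bar>a\<bar> / 2)"
    by (cases "a \<ge> 0") (auto simp: abs_if)
  ultimately show ?thesis by simp
qed

text \<open>For \<open>z = exp \<tau>\<close> the equation \<open>z (2 cosh w - 2) = 1\<close> reads \<open>sinh (w/2)\<^sup>2 = exp (-\<tau>) / 4\<close>.
  The solution \<open>w\<close> of smallest modulus is obtained by choosing \<open>sinh (w/2) = exp (-\<tau>/2) / 2\<close> and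
  taking the principal branch of the inverse hyperbolic sine. The parameter \<open>\<tau>\<close> is used instead of
  \<open>z\<close> because all functions of \<open>\<tau>\<close> below are analytic near the closed segment
  \<open>phase_segment\<close>, endpoints included, while \<open>z\<close> returns to \<open>-1\<close> at both ends.\<close>

definition pole_sinh :: "complex \<Rightarrow> complex" where
  "pole_sinh \<tau> = exp (- \<tau> / 2) / 2"

definition pole_cosh :: "complex \<Rightarrow> complex" where
  "pole_cosh \<tau> = csqrt (1 + pole_sinh \<tau> ^ 2)"

definition pole :: "complex \<Rightarrow> complex" where
  "pole \<tau> = 2 * Ln (pole_sinh \<tau> + pole_cosh \<tau>)"

definition phase_segment :: "complex set" where
  "phase_segment = {\<tau>. Re \<tau> = 0 \<and> \<bar>Im \<tau>\<bar> \<le> pi}"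

context
  fixes \<tau> :: complex
  assumes \<tau>: "\<tau> \<in> phase_segment"
begin

lemma Re_pole_sinh: "0 \<le> Re (pole_sinh \<tau>)"
  using \<tau> by (auto simp: pole_sinh_def phase_segment_def Re_exp intro!: cos_ge_zero)

lemma norm_pole_sinh: "cmod (pole_sinh \<tau>) = 1 / 2"
  using \<tau> by (simp add: pole_sinh_def phase_segment_def norm_divide)

text \<open>As \<open>sinh (w/2)\<close> has modulus \<open>1/2\<close> on the segment, \<open>1 + sinh (w/2)\<^sup>2\<close> stays away from the branch
  cut of the square root.\<close>

lemma Re_radicand: "3 / 4 \<le> Re (1 + pole_sinh \<tau> ^ 2)"
proof -
  have "\<bar>Re (pole_sinh \<tau> ^ 2)\<bar> \<le> cmod (pole_sinh \<tau> ^ 2)" by (rule abs_Re_le_cmod)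
  also have "\<dots> = 1 / 4" by (simp only: norm_power norm_pole_sinh) (simp add: power2_eq_square)
  finally show ?thesis by (simp add: abs_le_iff)
qed

lemma pole_cosh_squared: "pole_cosh \<tau> ^ 2 = 1 + pole_sinh \<tau> ^ 2"
  by (simp add: pole_cosh_def)

lemma Re_pole_cosh: "0 < Re (pole_cosh \<tau>)"
proof -
  have "Re (pole_cosh \<tau> ^ 2) > 0" using Re_radicand by (simp only: pole_cosh_squared)
  hence "Re (pole_cosh \<tau>) \<noteq> 0" by (auto simp: power2_eq_square not_less)
  thus ?thesis using Re_csqrt[of "1 + pole_sinh \<tau> ^ 2"] by (simp add: pole_cosh_def)
qed

lemma norm_pole_cosh: "3 / 4 \<le> cmod (pole_cosh \<tau>) ^ 2"
proof -
  have "3 / 4 \<le> Re (pole_cosh \<tau> ^ 2)" using Re_radicand by (simp only: pole_cosh_squared)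
  also have "\<dots> \<le> cmod (pole_cosh \<tau> ^ 2)" by (rule complex_Re_le_cmod)
  finally show ?thesis by (simp add: norm_power)
qed

lemma pole_cosh_nz: "pole_cosh \<tau> \<noteq> 0" 
  using Re_pole_cosh by auto

lemma Re_pole_exp: "0 < Re (pole_sinh \<tau> + pole_cosh \<tau>)"
  using Re_pole_sinh Re_pole_cosh by simp

lemma pole_exp_nz: "pole_sinh \<tau> + pole_cosh \<tau> \<noteq> 0"
  using Re_pole_exp by (metis less_irrefl zero_complex.sel(1))

lemma exp_half_pole: "exp (pole \<tau> / 2) = pole_sinh \<tau> + pole_cosh \<tau>"
  using pole_exp_nz by (simp add: pole_def)

lemma exp_minus_half_pole: "exp (- (pole \<tau> / 2)) = pole_cosh \<tau> - pole_sinh \<tau>"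
proof -
  have "(pole_sinh \<tau> + pole_cosh \<tau>) * (pole_cosh \<tau> - pole_sinh \<tau>) = pole_cosh \<tau> ^ 2 - pole_sinh \<tau> ^ 2"
    by (simp add: power2_eq_square algebra_simps)
  also have "\<dots> = 1" by (simp add: pole_cosh_squared)
  finally have "inverse (pole_sinh \<tau> + pole_cosh \<tau>) = pole_cosh \<tau> - pole_sinh \<tau>"
    by (rule inverse_unique)
  thus ?thesis by (simp only: exp_minus exp_half_pole)
qed

lemma sinh_half_pole: "sinh (pole \<tau> / 2) = pole_sinh \<tau>"
  unfolding sinh_field_def exp_half_pole exp_minus_half_pole by simp

lemma cosh_half_pole: "cosh (pole \<tau> / 2) = pole_cosh \<tau>"
  unfolding cosh_field_def exp_half_pole exp_minus_half_pole by simp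

text \<open>This is \<open>|sinh (w/2)|\<^sup>2 = 1/4\<close> in real and imaginary parts; it controls the position of the pole.\<close>

lemma sinh_sin_pole: "(sinh (Re (pole \<tau>) / 2))^2 + (sin (Im (pole \<tau>) / 2))^2 = 1 / 4"
  using cmod_sinh_squared[of "pole \<tau> / 2"]
  by (simp add: sinh_half_pole norm_pole_sinh power2_eq_square)

lemma abs_Im_pole: "\<bar>Im (pole \<tau>)\<bar> \<le> pi / 3"
proof -
  define y where "y = \<bar>Im (pole \<tau>) / 2\<bar>"
  have y: "y < pi / 2"
    using Re_pole_exp pole_exp_nz Re_Ln_pos_lt[of "pole_sinh \<tau> + pole_cosh \<tau>"]
    by (auto simp: pole_def y_def)
  have "(sin y)^2 \<le> (1/2)^2"
  proof -
    have "(sin y)^2 = (sin (Im (pole \<tau>) / 2))^2" by (auto simp: y_def abs_if)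
    thus ?thesis
      using sinh_sin_pole zero_le_power2[of "sinh (Re (pole \<tau>) / 2)"]
      unfolding power_one_over power2_eq_square[of 2] by linarith
  qed
  hence "\<bar>sin y\<bar> \<le> sin (pi / 6)"
    unfolding abs_le_square_iff[symmetric] by (simp add: sin_30)
  hence "y \<le> pi / 6"
    using y by (subst (asm) abs_of_nonneg) (auto simp: y_def sin_mono_le_eq intro!: sin_ge_zero)
  thus ?thesis by (simp add: y_def)
qed

lemma abs_Re_pole: "\<bar>Re (pole \<tau>)\<bar> \<le> omega"
proof -
  have "(sinh (Re (pole \<tau>) / 2))^2 \<le> (sinh (omega / 2))^2"
    unfolding sinh_half_omega power_one_over power2_eq_square[of 2]
    using sinh_sin_pole zero_le_power2[of "sin (Im (pole \<tau>) / 2)"] by linarith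
  hence "\<bar>sinh (Re (pole \<tau>) / 2)\<bar> \<le> sinh (omega / 2)"
    unfolding abs_le_square_iff[symmetric] by (simp add: sinh_half_omega)
  hence "sinh (Re (pole \<tau>) / 2) \<le> sinh (omega / 2)" "sinh (- (Re (pole \<tau>) / 2)) \<le> sinh (omega / 2)"
    by (auto simp: abs_le_iff simp del: sinh_real_le_iff)
  hence "Re (pole \<tau>) / 2 \<le> omega / 2" "- (Re (pole \<tau>) / 2) \<le> omega / 2"
    by (simp_all only: sinh_real_le_iff)
  thus ?thesis by simp
qed

lemma norm_pole_le: "cmod (pole \<tau>) \<le> 2"
proof -
  have "(cmod (pole \<tau>))^2 = \<bar>Re (pole \<tau>)\<bar>^2 + \<bar>Im (pole \<tau>)\<bar>^2"
    by (simp add: cmod_power2)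
  also have "\<dots> \<le> 1^2 + (11/10)^2"
    using abs_Re_pole abs_Im_pole omega_less_1 pi_approx by (intro add_mono power_mono) auto
  also have "\<dots> \<le> 2^2" by (simp add: power2_eq_square)
  finally show ?thesis by (rule power2_le_imp_le) simp
qed

text \<open>Let \<open>w = a + ib\<close>. Estimating \<open>sinh (a/2)\<^sup>2 + sin (b/2)\<^sup>2 = 1/4\<close> from above by the chord bound for
  \<open>sinh\<close> and by \<open>|sin y| \<le> |y|\<close> gives \<open>1 \<le> a\<^sup>2/\<omega>\<^sup>2 + b\<^sup>2\<close>. Since \<open>\<omega> < 1\<close>, an imaginary part moves
  the pole strictly away from the origin.\<close>

lemma norm_pole_squared_ge: "omega^2 + (1 - omega^2) * (Im (pole \<tau>))^2 \<le> (cmod (pole \<tau>))^2"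
proof -
  define a b where "a = Re (pole \<tau>)" and "b = Im (pole \<tau>)"
  have "1 / 4 = \<bar>sinh (a / 2)\<bar>^2 + \<bar>sin (b / 2)\<bar>^2"
    using sinh_sin_pole by (simp add: a_def b_def)
  also have "\<dots> \<le> (\<bar>a\<bar> / (2 * omega))^2 + \<bar>b / 2\<bar>^2"
    by (intro add_mono power_mono abs_sinh_half_le_chord abs_sin_x_le_abs_x) (auto simp: a_def abs_Re_pole)
  finally have "1 \<le> a^2 / omega^2 + b^2"
    by (simp add: power_divide power_mult_distrib)
  hence "omega^2 * 1 \<le> omega^2 * (a^2 / omega^2 + b^2)"
    by (intro mult_left_mono) auto
  hence "omega^2 \<le> a^2 + omega^2 * b^2"
    using omega_pos by (simp add: algebra_simps)
  thus ?thesis by (simp add: cmod_power2 a_def b_def algebra_simps)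
qed

text \<open>The imaginary part of \<open>sinh (w/2) = exp (-\<tau>/2) / 2\<close> is \<open>cosh (a/2) sin (b/2) = -sin (t/2) / 2\<close> for
  \<open>w = a + ib\<close> and \<open>\<tau> = it\<close>, so \<open>b\<close> cannot be much smaller than \<open>t\<close>.\<close>

lemma abs_Im_pole_ge: "\<bar>Im \<tau>\<bar> / 8 \<le> \<bar>Im (pole \<tau>)\<bar>"
proof -
  have "(cosh (Re (pole \<tau>) / 2))^2 \<le> 2^2"
    unfolding cosh_square_eq power2_eq_square[of 2] using sinh_sin_pole zero_le_power2[of "sin (Im (pole \<tau>) / 2)"] by linarith
  hence c: "cosh (Re (pole \<tau>) / 2) \<le> 2"
    by (rule power2_le_imp_le) simp
  have "\<bar>Im \<tau> / 2\<bar> / 2 \<le> \<bar>sin (Im \<tau> / 2)\<bar>"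
    using \<tau> by (intro abs_sin_ge_half) (auto simp: phase_segment_def)
  also have "\<dots> = 2 * \<bar>Im (pole_sinh \<tau>)\<bar>"
    using \<tau> by (simp add: pole_sinh_def Im_exp phase_segment_def)
  also have "\<dots> = 2 * (cosh (Re (pole \<tau>) / 2) * \<bar>sin (Im (pole \<tau>) / 2)\<bar>)"
    unfolding sinh_half_pole[symmetric] Im_sinh_complex by (simp add: abs_mult)
  also have "\<dots> \<le> 2 * (2 * \<bar>Im (pole \<tau>) / 2\<bar>)"
    using c by (intro mult_left_mono mult_mono abs_sin_x_le_abs_x) auto
  finally show ?thesis by simp
qed

lemma pole_nz: "pole \<tau> \<noteq> 0"
  using sinh_half_pole norm_pole_sinh by auto

lemma pole_not_nonpos_Real: "pole \<tau> \<notin> \<real>\<^sub>\<le>\<^sub>0"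
proof
  assume "pole \<tau> \<in> \<real>\<^sub>\<le>\<^sub>0"
  hence *: "Im (pole \<tau>) = 0" "Re (pole \<tau>) \<le> 0" by (auto simp: complex_nonpos_Reals_iff)
  hence "Re (pole_sinh \<tau>) = sinh (Re (pole \<tau>) / 2)"
    unfolding sinh_half_pole[symmetric] Re_sinh_complex by simp
  moreover have "sinh (Re (pole \<tau>) / 2) < 0"
    using * pole_nz by (auto simp: complex_eq_iff)
  ultimately show False using Re_pole_sinh by simp
qed

end

lemma pole_cosh_0: "pole_cosh 0 = of_real (sqrt 5 / 2)"
proof -
  have "csqrt (1 + (1 / 2)\<^sup>2) = of_real (sqrt (5 / 4))"
    by (rule csqrt_unique) (auto simp: power_divide simp flip: of_real_power)
  thus ?thesis
    by (simp add: pole_cosh_def pole_sinh_def real_sqrt_divide del: of_real_sqrt)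
qed

lemma pole_0: "pole 0 = of_real omega"
proof -
  have "pole_sinh 0 + pole_cosh 0 = of_real ((sqrt 5 + 1) / 2)"
    by (simp add: pole_sinh_def pole_cosh_0 add_divide_distrib)
  hence "pole 0 = 2 * Ln (of_real ((sqrt 5 + 1) / 2))"
    by (simp only: pole_def)
  also have "\<dots> = of_real omega"
    unfolding omega_def using sqrt_5_gt by (subst Ln_of_real) auto
  finally show ?thesis .
qed

text \<open>By \<open>norm_pole_squared_ge\<close> and \<open>abs_Im_pole_ge\<close> the modulus of the pole exceeds \<open>\<omega>\<close> by at least
  a multiple of \<open>t\<^sup>2\<close>. This yields the Gaussian decay of the main term over the whole period.\<close>

lemma norm_pole_gaussian_lower_bound:
  obtains c where "0 < c" "\<And>\<tau>. \<tau> \<in> phase_segment \<Longrightarrow> omega * exp (c * (Im \<tau>)^2) \<le> cmod (pole \<tau>)"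
proof
  \<comment> \<open>The exponent \<open>k/256\<close> collects \<open>1/64\<close> from the square of \<open>|b| \<ge> |t|/8\<close>, a factor \<open>1/2\<close> from
    \<open>exp y \<le> 1 + 2y\<close> and a factor \<open>1/2\<close> from comparing squares; \<open>k \<le> 1\<close> ensures \<open>y \<le> 1/2\<close>.\<close>
  define k where "k = min 1 ((1 - omega^2) / omega^2)"
  have "omega^2 < 1^2" using omega_pos omega_less_1 by (intro power_strict_mono) auto
  hence "omega^2 \<le> 1" by simp
  from \<open>omega^2 < 1^2\<close> have k: "0 < k" "k \<le> 1" "k * omega^2 \<le> 1 - omega^2"
    using omega_pos by (auto simp: k_def min_def field_simps)
  show "0 < k / 256" using k by simp
  fix \<tau> assume \<tau>: "\<tau> \<in> phase_segment"
  define y where "y = k * (Im \<tau>)^2 / 128"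
  have "\<bar>Im \<tau>\<bar> \<le> 4" using \<tau> pi_less_4 by (auto simp: phase_segment_def)
  hence "(Im \<tau>)^2 \<le> 4^2" by (metis abs_ge_zero power2_abs power_mono)
  hence "k * (Im \<tau>)^2 \<le> 1 * 16" using k by (intro mult_mono) auto
  hence y: "0 \<le> y" "y \<le> 1/2" using k by (auto simp: y_def)
  have "(omega * exp (k / 256 * (Im \<tau>)^2))^2 = omega^2 * exp y"
    unfolding power_mult_distrib exp_double[symmetric] by (simp add: y_def)
  also have "\<dots> \<le> omega^2 * (1 + 2 * y)"
    using y by (intro mult_left_mono real_exp_bound_lemma) auto
  also have "\<dots> = omega^2 + k * omega^2 * (\<bar>Im \<tau>\<bar> / 8)^2"
    by (simp add: y_def power_divide algebra_simps)
  also have "\<dots> \<le> omega^2 + (1 - omega^2) * \<bar>Im (pole \<tau>)\<bar>^2"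
    using k \<open>omega^2 \<le> 1\<close> abs_Im_pole_ge[OF \<tau>] by (intro add_left_mono mult_mono power_mono) auto
  also have "\<dots> \<le> (cmod (pole \<tau>))^2"
    using norm_pole_squared_ge[OF \<tau>] by simp
  finally show "omega * exp (k / 256 * (Im \<tau>)^2) \<le> cmod (pole \<tau>)"
    by (rule power2_le_imp_le) simp
qed

section \<open>Coefficient asymptotics, uniform on the unit circle\<close>

text \<open>The entire function \<open>sinh y / y\<close>. It has no zero of modulus less than \<open>pi\<close>, hence is bounded away
  from zero on the disc of radius 3.\<close>

definition sinhc :: "complex \<Rightarrow> complex" where
  "sinhc y = (if y = 0 then 1 else sinh y / y)"

lemma sinhc_mult: "y * sinhc y = sinh y"
  by (simp add: sinhc_def)

lemma holomorphic_sinhc [holomorphic_intros]: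
  assumes "f holomorphic_on A"
  shows "(\<lambda>x. sinhc (f x)) holomorphic_on A"
proof -
  have "deriv sinh (0::complex) = 1"
    by (rule DERIV_imp_deriv) (auto intro!: derivative_eq_intros)
  hence "sinhc = (\<lambda>z. if z = 0 then deriv sinh 0 else (sinh z - sinh 0) / (z - 0))"
    by (auto simp: sinhc_def fun_eq_iff)
  moreover have "sinh holomorphic_on (UNIV :: complex set)"
    unfolding sinh_field_def[abs_def] by (intro holomorphic_intros) auto
  ultimately have "sinhc holomorphic_on UNIV"
    using pole_lemma[of sinh UNIV 0] by simp
  thus ?thesis using holomorphic_on_compose_gen[OF assms, of sinhc UNIV] by (simp add: o_def)
qed

lemma sinhc_nz: "sinhc y \<noteq> 0" if "cmod y \<le> 3"
proof
  assume 0: "sinhc y = 0"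
  hence y: "y \<noteq> 0" by (auto simp: sinhc_def)
  have "sinh y = 0" using sinhc_mult[of y] 0 by simp
  hence "exp y = exp (- y)" by (simp add: sinh_field_def)
  hence "exp (2 * y) = 1" 
    by (metis add.right_inverse exp_add exp_zero mult_2)
  then obtain n :: int where n: "Re y = 0" "Im y = of_int n * pi"
    by (auto simp: exp_eq_1)
  have "n \<noteq> 0" using y n by (auto simp: complex_eq_iff)
  hence "1 * pi \<le> \<bar>of_int n\<bar> * pi" by (intro mult_right_mono) auto
  also have "\<dots> = \<bar>Im y\<bar>" by (simp add: n abs_mult)
  also have "\<dots> \<le> 3" using that abs_Im_le_cmod[of y] by linarith
  finally show False using pi_gt3 by simp
qed

lemma sinhc_lower_bound:
  obtains m where "0 < m" "\<And>y. cmod y \<le> 3 \<Longrightarrow> m \<le> cmod (sinhc y)"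
proof -
  have "continuous_on (cball 0 3) (\<lambda>y. cmod (sinhc y))"
    by (intro continuous_on_norm holomorphic_on_imp_continuous_on holomorphic_intros)
  from continuous_attains_inf[OF compact_cball _ this]
  obtain x where "x \<in> cball 0 3" "\<And>y. y \<in> cball 0 3 \<Longrightarrow> cmod (sinhc x) \<le> cmod (sinhc y)"
    by auto
  thus ?thesis using that[of "cmod (sinhc x)"] sinhc_nz[of x] by auto
qed

text \<open>From \<open>z \<cdot> 4 sinh (w/2)\<^sup>2 = 1\<close> one gets \<open>1 - z C(x) = 4z (sinh (w/2)\<^sup>2 - sinh (x/2)\<^sup>2)\<close>, and the
  difference of squares factors as \<open>sinh ((w-x)/2) sinh ((w+x)/2)\<close>. This isolates the zeros \<open>w\<close> and
  \<open>-w\<close> explicitly, for all \<open>z\<close> on the unit circle simultaneously.\<close>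

lemma one_minus_versine_factorization:
  assumes "\<tau> \<in> phase_segment"
  shows "1 - exp \<tau> * (2 * cosh x - 2)
    = exp \<tau> * sinhc ((pole \<tau> - x) / 2) * sinhc ((pole \<tau> + x) / 2) * (pole \<tau> ^ 2 - x ^ 2)"
proof -
  define w where "w = pole \<tau>"
  have v: "exp \<tau> * (4 * sinh (w / 2) ^ 2) = 1"
    unfolding w_def sinh_half_pole[OF assms] pole_sinh_def
    by (simp add: power2_eq_square flip: exp_add)
  have "4 * (sinh (w / 2) ^ 2 - sinh (x / 2) ^ 2) = 4 * (sinh (w / 2 - x / 2) * sinh (w / 2 + x / 2))"
    unfolding sinh_add sinh_diff
    using cosh_square_eq[of "w / 2"] cosh_square_eq[of "x / 2"] by algebra
  also have "\<dots> = sinhc ((w - x) / 2) * sinhc ((w + x) / 2) * (w^2 - x^2)"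
    unfolding sinhc_mult[symmetric, of "w / 2 - x / 2"] sinhc_mult[symmetric, of "w / 2 + x / 2"]
    by (simp add: add_divide_distrib diff_divide_distrib power2_eq_square algebra_simps)
  finally have *: "4 * (sinh (w / 2) ^ 2 - sinh (x / 2) ^ 2) = \<dots>" .
  have "2 * cosh x - 2 = 4 * sinh (x / 2) ^ 2"
    using cosh_double[of "x / 2"] by (simp add: cosh_square_eq)
  hence "1 - exp \<tau> * (2 * cosh x - 2) = exp \<tau> * (4 * (sinh (w / 2) ^ 2 - sinh (x / 2) ^ 2))"
    using v by (simp add: algebra_simps)
  also note *
  finally show ?thesis by (simp add: w_def mult_ac)
qed

text \<open>Applied to the power series of an even function, whose terms of odd degree cancel.\<close>

lemma sums_even_terms:
  fixes h :: "nat \<Rightarrow> complex"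
  assumes "(\<lambda>k. h k * w ^ k) sums s" "(\<lambda>k. h k * (- w) ^ k) sums s"
  shows "(\<lambda>k. h (2 * k) * w ^ (2 * k)) sums s"
proof -
  have "(\<lambda>k. (h k * w ^ k + h k * (- w) ^ k) / 2) sums ((s + s) / 2)"
    by (intro sums_add sums_divide assms)
  also have "(\<lambda>k. (h k * w ^ k + h k * (- w) ^ k) / 2) = (\<lambda>k. if even k then h k * w ^ k else 0)"
    by (auto simp: fun_eq_iff)
  finally have "(\<lambda>k. if even k then h k * w ^ k else 0) sums s" by simp
  moreover have "strict_mono (\<lambda>k::nat. 2 * k)" by (auto simp: strict_mono_def)
  ultimately have "(\<lambda>k. (\<lambda>k. if even k then h k * w ^ k else 0) (2 * k)) sums s"
    by (subst sums_mono_reindex) auto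
  thus ?thesis by simp
qed

lemma norm_sums_tail_le:
  fixes a :: "nat \<Rightarrow> complex"
  assumes "a sums s" "\<And>k. cmod (a k) \<le> B * q ^ k" "0 \<le> q" "q < 1"
  shows "cmod ((\<Sum>k\<le>n. a k) - s) \<le> B * q ^ Suc n / (1 - q)"
proof -
  have "(\<lambda>k. a (k + Suc n)) sums (s - (\<Sum>k<Suc n. a k))"
    using assms(1) by (rule sums_split_initial_segment)
  hence "s - (\<Sum>k\<le>n. a k) = (\<Sum>k. a (k + Suc n))"
    unfolding lessThan_Suc_atMost by (rule sums_unique)
  moreover have g: "(\<lambda>k. B * q ^ Suc n * q ^ k) sums (B * q ^ Suc n * (1 / (1 - q)))"
    using assms by (intro sums_mult geometric_sums) auto
  moreover have "cmod (\<Sum>k. a (k + Suc n)) \<le> (\<Sum>k. B * q ^ Suc n * q ^ k)"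
    using assms(2)[of "_ + Suc n"] g
    by (intro norm_suminf_le) (auto simp: sums_iff power_add mult_ac)
  ultimately show ?thesis by (simp add: sums_iff norm_minus_commute)
qed

text \<open>By the factorization, \<open>H(x) = (w\<^sup>2 - x\<^sup>2) / (1 - z C(x))\<close> is analytic on the disc of radius 3 and bounded
  there uniformly in \<open>z\<close>. If \<open>f_k\<close> and \<open>h_k\<close> are the coefficients of \<open>1 / (1 - z C)\<close> and of \<open>H\<close>, then
  \<open>h_k = w\<^sup>2 f_k - f_(k-2)\<close>. Therefore the sum of \<open>h_(2k) w^(2k)\<close> over \<open>k \<le> n\<close> telescopes to
  \<open>f_(2n) w^(2n+2)\<close>, while it differs from \<open>H(w)\<close> by the tail of a convergent power series, which
  Cauchy's inequality estimates.\<close>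

lemma geometric_fps_nth_asymptotics:
  obtains B where "0 < B"
    "\<And>\<tau> n. \<tau> \<in> phase_segment \<Longrightarrow>
       cmod (fps_nth (inverse (1 - fps_const (exp \<tau>) * versine_fps)) (2 * n)
              - 2 * pole_sinh \<tau> / (pole_cosh \<tau> * pole \<tau> ^ (2 * n + 1))) \<le> B * (1 / 9) ^ n"
proof -
  obtain m where m: "0 < m" "\<And>y. cmod y \<le> 3 \<Longrightarrow> m \<le> cmod (sinhc y)"
    using sinhc_lower_bound by blast
  define B where "B = inverse (m * m)"
  have B: "0 < B" using m by (simp add: B_def)
  have bound: "cmod (fps_nth (inverse (1 - fps_const (exp \<tau>) * versine_fps)) (2 * n)
              - 2 * pole_sinh \<tau> / (pole_cosh \<tau> * pole \<tau> ^ (2 * n + 1))) \<le> B * (1 / 9) ^ n"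
    if \<tau>: "\<tau> \<in> phase_segment" for \<tau> n
  proof -
    define w where "w = pole \<tau>"
    define z where "z = exp \<tau>"
    define H where "H = (\<lambda>x. inverse (z * sinhc ((w - x) / 2) * sinhc ((w + x) / 2)))"
    define F where "F = inverse (1 - fps_const z * versine_fps)"
    define G where "G = F * (fps_const (w ^ 2) - fps_X ^ 2)"
    have w: "w \<noteq> 0" "cmod w \<le> 2" using \<tau> by (simp_all add: w_def pole_nz norm_pole_le)
    have z: "cmod z = 1" using \<tau> by (simp add: z_def phase_segment_def)
    \<comment> \<open>The disc of radius 3 is the domain of the lower bound for \<open>sinhc\<close>, and \<open>|w| \<le> 2\<close>.\<close>
    have near: "cmod ((w - x) / 2) \<le> 3" "cmod ((w + x) / 2) \<le> 3" if "cmod x \<le> 3" for x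
      using norm_triangle_ineq4[of w x] norm_triangle_ineq[of w x] w that by (auto simp: norm_divide)
    have hol: "H holomorphic_on cball 0 3"
      unfolding H_def using z sinhc_nz[OF near(1)] sinhc_nz[OF near(2)]
      by (intro holomorphic_intros) auto
    have H_le: "cmod (H x) \<le> B" if "cmod x \<le> 3" for x
    proof -
      have "m * m \<le> cmod (sinhc ((w - x) / 2)) * cmod (sinhc ((w + x) / 2))"
        using m near[OF that] by (intro mult_mono) auto
      hence "inverse (cmod (sinhc ((w - x) / 2)) * cmod (sinhc ((w + x) / 2))) \<le> inverse (m * m)"
        by (rule le_imp_inverse_le) (use m(1) in simp)
      thus ?thesis using z by (simp add: H_def B_def norm_mult norm_inverse)
    qed
    have "(\<lambda>x. inverse (1 - z * (2 * cosh x - 2)) * (w ^ 2 - x ^ 2)) has_fps_expansion G"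
      unfolding G_def F_def
      by (intro fps_expansion_intros versine_has_fps_expansion) auto
    moreover have "eventually (\<lambda>x. inverse (1 - z * (2 * cosh x - 2)) * (w ^ 2 - x ^ 2) = H x) (nhds 0)"
    proof (rule eventually_nhds_in_open[of "ball (0::complex) (cmod w)", THEN eventually_mono])
      fix x :: complex assume "x \<in> ball 0 (cmod w)"
      hence nz: "pole \<tau> ^ 2 - x ^ 2 \<noteq> 0"
        by (auto simp: power2_eq_iff w_def)
      have cancel: "inverse (a * d) * d = inverse a" if "d \<noteq> 0" for a d :: complex
        using that by simp
      show "inverse (1 - z * (2 * cosh x - 2)) * (w ^ 2 - x ^ 2) = H x"
        unfolding z_def one_minus_versine_factorization[OF \<tau>] H_def w_def
        by (rule cancel[OF nz])
    qed (use w in auto)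
    ultimately have "H has_fps_expansion G"
      by (subst (asm) has_fps_expansion_cong[OF _ refl]) assumption+
    hence h: "fps_nth G k = (deriv ^^ k) H 0 / fact k" for k
      by (rule fps_nth_fps_expansion)
    have G_le: "cmod (fps_nth G k) \<le> B * (1 / 3) ^ k" for k
    proof -
      have "cmod ((deriv ^^ k) H 0) \<le> fact k * B / 3 ^ k"
        by (rule Cauchy_inequality)
           (use H_le holomorphic_on_imp_continuous_on[OF hol] holomorphic_on_subset[OF hol, of "ball 0 3"] in auto)
      thus ?thesis by (simp add: h norm_divide field_simps power_one_over)
    qed
    have H_sums: "(\<lambda>k. fps_nth G k * x ^ k) sums H x" if "cmod x < 3" for x
      using holomorphic_power_series[OF holomorphic_on_subset[OF hol], of 0 3 x] that by (simp add: h)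
    have "H (- w) = H w" by (simp add: H_def mult_ac)
    hence sums: "(\<lambda>k. fps_nth G (2 * k) * w ^ (2 * k)) sums H w"
      using H_sums[of w] H_sums[of "- w"] w by (intro sums_even_terms) auto
    have partial: "(\<Sum>k\<le>n. fps_nth G (2 * k) * w ^ (2 * k)) = fps_nth F (2 * n) * w ^ (2 * n + 2)" for n
    proof (induction n)
      case 0
      show ?case by (simp add: G_def power2_eq_square)
    next
      case (Suc n)
      have G_Suc: "fps_nth G (2 * Suc n) = w ^ 2 * fps_nth F (2 * Suc n) - fps_nth F (2 * n)"
        by (simp add: G_def algebra_simps fps_X_power_mult_right_nth)
      show ?case unfolding sum.atMost_Suc Suc.IH G_Suc
        by (simp add: algebra_simps power2_eq_square)
    qed
    \<comment> \<open>The ratio of the geometric series that dominates the tail.\<close>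
    define q where "q = (cmod w / 3) ^ 2"
    have "q \<le> (2 / 3) ^ 2" unfolding q_def using w by (intro power_mono) auto
    hence q: "0 \<le> q" "q \<le> 4 / 9" by (auto simp: q_def power2_eq_square)
    have "cmod ((\<Sum>k\<le>n. fps_nth G (2 * k) * w ^ (2 * k)) - H w) \<le> B * q ^ Suc n / (1 - q)"
    proof (rule norm_sums_tail_le[OF sums])
      show "cmod (fps_nth G (2 * k) * w ^ (2 * k)) \<le> B * q ^ k" for k
      proof -
        have "cmod (fps_nth G (2 * k) * w ^ (2 * k)) \<le> B * (1 / 3) ^ (2 * k) * cmod w ^ (2 * k)"
          unfolding norm_mult norm_power by (intro mult_right_mono G_le) auto
        also have "\<dots> = B * (1 / 3 * cmod w) ^ (2 * k)"
          by (simp only: power_mult_distrib mult.assoc)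
        also have "\<dots> = B * q ^ k" by (simp add: q_def power_mult)
        finally show ?thesis .
      qed
    qed (use q in auto)
    \<comment> \<open>The factor 9 is larger than required; it cancels against \<open>(1/9)^(n+1)\<close> below.\<close>
    also have "\<dots> \<le> B * q ^ Suc n * 9"
    proof -
      have "B * q ^ Suc n * 1 \<le> B * q ^ Suc n * (9 * (1 - q))"
        using B q by (intro mult_left_mono) auto
      hence "B * q ^ Suc n \<le> B * q ^ Suc n * 9 * (1 - q)"
        by (simp only: mult.assoc mult_1_right)
      moreover have "0 < 1 - q" using q by simp
      ultimately show ?thesis by (simp only: pos_divide_le_eq)
    qed
    finally have "cmod (fps_nth F (2 * n) * w ^ (2 * n + 2) - H w) \<le> B * q ^ Suc n * 9"
      unfolding partial .
    hence "cmod ((fps_nth F (2 * n) * w ^ (2 * n + 2) - H w) / w ^ (2 * n + 2))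
         \<le> B * q ^ Suc n * 9 / cmod w ^ (2 * n + 2)"
      unfolding norm_divide norm_power by (intro divide_right_mono) auto
    also have "q ^ Suc n = cmod w ^ (2 * n + 2) * (1 / 9) ^ Suc n"
      by (simp add: q_def power_divide power_mult_distrib power2_eq_square mult_2 power_add)
    also have "B * (cmod w ^ (2 * n + 2) * (1 / 9) ^ Suc n) * 9 / cmod w ^ (2 * n + 2) = B * (1 / 9) ^ n"
      using w by simp
    also have "(fps_nth F (2 * n) * w ^ (2 * n + 2) - H w) / w ^ (2 * n + 2)
        = fps_nth F (2 * n) - H w / w ^ (2 * n + 2)"
      using w by (simp add: diff_divide_distrib)
    also have "H w / w ^ (2 * n + 2) = 2 * pole_sinh \<tau> / (pole_cosh \<tau> * w ^ (2 * n + 1))"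
    proof -
      define v s where "v = pole_sinh \<tau>" and "s = pole_cosh \<tau>"
      have v: "z * (4 * v ^ 2) = 1"
        unfolding v_def pole_sinh_def z_def by (simp add: power2_eq_square flip: exp_add)
      have "w * sinhc w = 2 * v * s"
        unfolding sinhc_mult using sinh_double[of "w / 2"]
        by (simp add: w_def v_def s_def sinh_half_pole[OF \<tau>] cosh_half_pole[OF \<tau>])
      hence S: "sinhc w = 2 * v * s / w" using w by (simp add: field_simps)
      have Z: "inverse z = 4 * v ^ 2" using v by (rule inverse_unique)
      have "v \<noteq> 0" "s \<noteq> 0" using v pole_cosh_nz[OF \<tau>] by (auto simp: s_def)
      have "H w = inverse z * inverse (sinhc w)" by (simp add: H_def sinhc_def)
      also have "\<dots> = w * (2 * v) / s"
        unfolding S Z using \<open>v \<noteq> 0\<close> \<open>s \<noteq> 0\<close> w by (simp add: field_simps power2_eq_square)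
      finally have "H w = w * (2 * v) / s" .
      thus ?thesis using w by (simp add: v_def s_def)
    qed
    finally show ?thesis by (simp add: F_def z_def w_def)
  qed
  show ?thesis using that[of B] B bound by blast
qed

section \<open>Cumulant expansion of the residue\<close>

lemma convex_phase_segment: "convex phase_segment"
proof (rule convexI)
  fix x y :: complex and u v :: real
  assume *: "x \<in> phase_segment" "y \<in> phase_segment" "0 \<le> u" "0 \<le> v" "u + v = 1"
  have "\<bar>u * Im x + v * Im y\<bar> \<le> u * \<bar>Im x\<bar> + v * \<bar>Im y\<bar>"
    using * abs_triangle_ineq[of "u * Im x" "v * Im y"] by (simp add: abs_mult)
  also have "\<dots> \<le> pi" using * by (intro convex_bound_le) (auto simp: phase_segment_def)
  finally show "u *\<^sub>R x + v *\<^sub>R y \<in> phase_segment" using * by (simp add: phase_segment_def)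
qed

lemma compact_phase_segment: "compact phase_segment"
proof -
  have "phase_segment = (\<lambda>t. \<i> * of_real t) ` {-pi..pi}"
  proof (intro equalityI subsetI)
    fix \<tau> assume "\<tau> \<in> phase_segment"
    thus "\<tau> \<in> (\<lambda>t. \<i> * of_real t) ` {-pi..pi}"
      by (intro image_eqI[of _ _ "Im \<tau>"]) (auto simp: phase_segment_def complex_eq_iff abs_le_iff)
  qed (auto simp: phase_segment_def abs_le_iff)
  also have "compact \<dots>"
    by (intro compact_continuous_image continuous_intros) auto
  finally show ?thesis .
qed

lemma zero_in_phase_segment: "0 \<in> phase_segment"
  by (simp add: phase_segment_def)

text \<open>The segment is compact, so continuity of the fourth derivative along it gives the uniform constant.\<close>

lemma Taylor_on_phase_segment:
  fixes f0 f1 f2 f3 f4 :: "complex \<Rightarrow> complex"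
  assumes "\<And>x. x \<in> phase_segment \<Longrightarrow> (f0 has_field_derivative f1 x) (at x)"
    and "\<And>x. x \<in> phase_segment \<Longrightarrow> (f1 has_field_derivative f2 x) (at x)"
    and "\<And>x. x \<in> phase_segment \<Longrightarrow> (f2 has_field_derivative f3 x) (at x)"
    and "\<And>x. x \<in> phase_segment \<Longrightarrow> (f3 has_field_derivative f4 x) (at x)"
    and "continuous_on phase_segment f4"
  shows "\<exists>K>0. \<forall>x\<in>phase_segment.
    cmod (f0 x - (f0 0 + f1 0 * x + f2 0 * x\<^sup>2 / 2 + f3 0 * x ^ 3 / 6)) \<le> K * cmod x ^ 4"
proof -
  have "compact (f4 ` phase_segment)"
    using assms(5) compact_phase_segment by (rule compact_continuous_image)
  then obtain B where B: "0 < B" "\<And>x. x \<in> phase_segment \<Longrightarrow> cmod (f4 x) \<le> B"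
    using compact_imp_bounded[of "f4 ` phase_segment"] unfolding bounded_pos by blast
  define f where "f = (\<lambda>i::nat. [f0, f1, f2, f3, f4] ! i)"
  have "cmod (f0 x - (f0 0 + f1 0 * x + f2 0 * x\<^sup>2 / 2 + f3 0 * x ^ 3 / 6)) \<le> B * cmod x ^ 4"
    if x: "x \<in> phase_segment" for x
  proof -
    have "cmod (f 0 x - (\<Sum>i\<le>3. f i 0 * (x - 0) ^ i / fact i)) \<le> B * cmod (x - 0) ^ Suc 3 / fact 3"
    proof (rule field_Taylor[OF convex_phase_segment])
      fix i :: nat and y assume "y \<in> phase_segment" "i \<le> 3"
      moreover from \<open>i \<le> 3\<close> have "i = 0 \<or> i = 1 \<or> i = 2 \<or> i = 3" by auto
      ultimately show "(f i has_field_derivative f (Suc i) y) (at y within phase_segment)"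
        using assms(1-4)[of y, THEN has_field_derivative_at_within] by (elim disjE) (simp_all add: f_def)
    next
      show "cmod (f (Suc 3) y) \<le> B" if "y \<in> phase_segment" for y
        using B(2)[OF that] by (simp add: f_def)
    qed (fact zero_in_phase_segment x)+
    also have "(\<Sum>i\<le>3. f i 0 * (x - 0) ^ i / fact i) = f0 0 + f1 0 * x + f2 0 * x\<^sup>2 / 2 + f3 0 * x ^ 3 / 6"
      by (simp add: f_def numeral_eq_Suc)
    also have "B * cmod (x - 0) ^ Suc 3 / fact 3 \<le> B * cmod (x - 0) ^ Suc 3 / 1"
      using B(1) by (intro divide_left_mono) (auto simp: fact_ge_1)
    finally show ?thesis by (simp add: f_def)
  qed
  thus ?thesis using B(1) by blast
qed

text \<open>With \<open>r = tanh (w/2)\<close> all derivatives become polynomial: \<open>w' = -r\<close> and \<open>r' = -(r - r\<^sup>3)/2\<close>.\<close>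

definition pole_tanh :: "complex \<Rightarrow> complex" where
  "pole_tanh \<tau> = pole_sinh \<tau> / pole_cosh \<tau>"

context
  fixes \<tau> :: complex
  assumes \<tau>: "\<tau> \<in> phase_segment"
begin

lemma pole_sinh_deriv: "(pole_sinh has_field_derivative - pole_sinh \<tau> / 2) (at \<tau>)"
  unfolding pole_sinh_def[abs_def] by (auto intro!: derivative_eq_intros)

lemma pole_cosh_deriv: "(pole_cosh has_field_derivative - (pole_sinh \<tau>)\<^sup>2 / (2 * pole_cosh \<tau>)) (at \<tau>)"
proof -
  have "1 + (pole_sinh \<tau>)\<^sup>2 \<notin> \<real>\<^sub>\<le>\<^sub>0"
    using Re_radicand[OF \<tau>] by (auto simp: complex_nonpos_Reals_iff)
  hence "((\<lambda>\<tau>. csqrt (1 + (pole_sinh \<tau>)\<^sup>2)) has_field_derivative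
      (2 * pole_sinh \<tau> * (- pole_sinh \<tau> / 2)) / (2 * csqrt (1 + (pole_sinh \<tau>)\<^sup>2))) (at \<tau>)"
    by (auto intro!: derivative_eq_intros pole_sinh_deriv has_field_derivative_csqrt[THEN DERIV_chain2])
  thus ?thesis
    by (simp add: pole_cosh_def[abs_def] power2_eq_square)
qed

lemma pole_tanh_deriv: "(pole_tanh has_field_derivative - (pole_tanh \<tau> - pole_tanh \<tau> ^ 3) / 2) (at \<tau>)"
proof -
  define v s where "v = pole_sinh \<tau>" and "s = pole_cosh \<tau>"
  have s: "s \<noteq> 0" using pole_cosh_nz[OF \<tau>] by (simp add: s_def)
  have "(pole_tanh has_field_derivative (- v / 2 * s - v * (- v\<^sup>2 / (2 * s))) / (s * s)) (at \<tau>)"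
    unfolding pole_tanh_def[abs_def] v_def s_def
    by (rule DERIV_divide[OF pole_sinh_deriv pole_cosh_deriv pole_cosh_nz[OF \<tau>]])
  also have "(- v / 2 * s - v * (- v\<^sup>2 / (2 * s))) / (s * s) = - (v / s - (v / s) ^ 3) / 2"
    using s by (simp add: field_simps power2_eq_square power3_eq_cube)
  finally show ?thesis unfolding pole_tanh_def[of \<tau>] v_def s_def .
qed

lemma pole_deriv: "(pole has_field_derivative - pole_tanh \<tau>) (at \<tau>)"
proof -
  define v s where "v = pole_sinh \<tau>" and "s = pole_cosh \<tau>"
  have nz: "s \<noteq> 0" "v + s \<noteq> 0"
    using pole_cosh_nz[OF \<tau>] pole_exp_nz[OF \<tau>] by (simp_all add: s_def v_def)
  have "v + s \<notin> \<real>\<^sub>\<le>\<^sub>0"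
    using Re_pole_exp[OF \<tau>] by (auto simp: complex_nonpos_Reals_iff v_def s_def)
  hence "(pole has_field_derivative 2 * (inverse (v + s) * (- v / 2 + - v\<^sup>2 / (2 * s)))) (at \<tau>)"
    unfolding pole_def[abs_def] v_def s_def
    by (intro DERIV_cmult DERIV_chain2[OF has_field_derivative_Ln] DERIV_add pole_sinh_deriv pole_cosh_deriv)
  also have "2 * (inverse (v + s) * (- v / 2 + - v\<^sup>2 / (2 * s))) = - (v / s)"
  proof -
    have "- v / 2 + - v\<^sup>2 / (2 * s) = - (v / s) * (v + s) / 2"
      using nz by (simp add: field_simps power2_eq_square)
    thus ?thesis using nz by simp
  qed
  finally show ?thesis by (simp add: pole_tanh_def v_def s_def)
qed

lemma pole_inverse_deriv:
  "((\<lambda>\<tau>. inverse (pole \<tau>)) has_field_derivative pole_tanh \<tau> * inverse (pole \<tau>) ^ 2) (at \<tau>)"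
  using DERIV_inverse'[OF pole_deriv pole_nz[OF \<tau>]] by (simp add: power2_eq_square algebra_simps)

lemma Ln_pole_deriv:
  "((\<lambda>\<tau>. - Ln (pole \<tau>)) has_field_derivative pole_tanh \<tau> * inverse (pole \<tau>)) (at \<tau>)"
  using DERIV_minus[OF DERIV_chain2[OF has_field_derivative_Ln[OF pole_not_nonpos_Real[OF \<tau>]] pole_deriv]]
  by (simp add: mult_ac)

lemma Ln_pole_cosh_deriv:
  "((\<lambda>\<tau>. - \<tau> / 2 - Ln (pole_cosh \<tau>)) has_field_derivative (pole_tanh \<tau> ^ 2 - 1) / 2) (at \<tau>)"
proof -
  define v s where "v = pole_sinh \<tau>" and "s = pole_cosh \<tau>"
  have s: "s \<noteq> 0" using pole_cosh_nz[OF \<tau>] by (simp add: s_def)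
  have "s \<notin> \<real>\<^sub>\<le>\<^sub>0"
    using Re_pole_cosh[OF \<tau>] by (auto simp: complex_nonpos_Reals_iff s_def)
  hence "((\<lambda>\<tau>. - \<tau> / 2 - Ln (pole_cosh \<tau>)) has_field_derivative
      - 1 / 2 - inverse s * (- v\<^sup>2 / (2 * s))) (at \<tau>)"
    unfolding v_def s_def
    by (intro DERIV_diff DERIV_chain2[OF has_field_derivative_Ln] pole_cosh_deriv)
       (auto intro!: derivative_eq_intros)
  also have "- 1 / 2 - inverse s * (- v\<^sup>2 / (2 * s)) = ((v / s) ^ 2 - 1) / 2"
    using s by (simp add: field_simps power2_eq_square)
  finally show ?thesis by (simp add: pole_tanh_def v_def s_def)
qed

end

lemma pole_tanh_0: "pole_tanh 0 = of_real (1 / sqrt 5)"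
  by (simp add: pole_tanh_def pole_sinh_def pole_cosh_0)

lemma continuous_on_pole_tanh: "continuous_on phase_segment pole_tanh"
  by (rule DERIV_continuous_on, rule has_field_derivative_at_within, rule pole_tanh_deriv)

lemma continuous_on_pole_inverse: "continuous_on phase_segment (\<lambda>\<tau>. inverse (pole \<tau>))"
  by (rule DERIV_continuous_on, rule has_field_derivative_at_within, rule pole_inverse_deriv)

text \<open>The third derivative of the logarithm of the residue at \<open>\<tau> = 0\<close>; the first two are \<open>a'\<close> and \<open>b'\<close>.\<close>

definition third_cumulant :: "nat \<Rightarrow> real" where
  "third_cumulant n = (2 * real n + 1) * (2 / (25 * sqrt 5 * omega) - 6 / (25 * omega\<^sup>2) + 2 / (5 * sqrt 5 * omega ^ 3)) + 6 / 125"

text \<open>A logarithm of \<open>2v / (s w^(2n+1))\<close>, where \<open>v = sinh (w/2) = exp (-\<tau>/2) / 2\<close> and \<open>s = cosh (w/2)\<close>.\<close>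

definition log_residue :: "nat \<Rightarrow> complex \<Rightarrow> complex" where
  "log_residue n \<tau> = (2 * of_nat n + 1) * (- Ln (pole \<tau>)) + (- \<tau> / 2 - Ln (pole_cosh \<tau>))"

text \<open>The functions \<open>r = tanh (w/2)\<close> and \<open>q = 1/w\<close> satisfy an autonomous polynomial system of differential
  equations, so the derivatives up to order four of \<open>-log w\<close> and \<open>-\<tau>/2 - log s\<close> are polynomials in
  \<open>r\<close> and \<open>q\<close>, and their values at \<open>\<tau> = 0\<close> follow from \<open>r = 1/\<surd>5\<close> and \<open>q = 1/\<omega>\<close>.\<close>

lemma log_residue_Taylor:
  obtains K where "0 < K"
    "\<And>n \<tau>. \<tau> \<in> phase_segment \<Longrightarrow> cmod (log_residue n \<tau> - log_residue n 0
        - (of_real (a' n) * \<tau> + of_real (b' n) * \<tau>\<^sup>2 / 2 + of_real (third_cumulant n) * \<tau> ^ 3 / 6))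
      \<le> K * (2 * real n + 2) * cmod \<tau> ^ 4"
proof -
  define r q where "r = pole_tanh" and "q = (\<lambda>\<tau>. inverse (pole \<tau>))"
  \<comment> \<open>Here \<open>d\<close> is the derivative of \<open>r\<close>, and \<open>e\<close> is the factor with \<open>d' = e d\<close>.\<close>
  define d where "d = (\<lambda>\<tau>. - (r \<tau> - r \<tau> ^ 3) / 2)"
  define e where "e = (\<lambda>\<tau>. - (1 - 3 * r \<tau> ^ 2) / 2)"
  have r: "(r has_field_derivative d \<tau>) (at \<tau>)" if "\<tau> \<in> phase_segment" for \<tau>
    unfolding r_def d_def by (rule pole_tanh_deriv[OF that])
  have q: "(q has_field_derivative r \<tau> * q \<tau> ^ 2) (at \<tau>)" if "\<tau> \<in> phase_segment" for \<tau>
    unfolding r_def q_def by (rule pole_inverse_deriv[OF that])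
  have d: "(d has_field_derivative e \<tau> * d \<tau>) (at \<tau>)" if "\<tau> \<in> phase_segment" for \<tau>
    unfolding d_def e_def using r[OF that]
    by (auto intro!: derivative_eq_intros simp: d_def field_simps power2_eq_square)
  have e: "(e has_field_derivative 3 * r \<tau> * d \<tau>) (at \<tau>)" if "\<tau> \<in> phase_segment" for \<tau>
    unfolding e_def using r[OF that] by (auto intro!: derivative_eq_intros simp: power2_eq_square)
  note D = r q d e
  have cont: "continuous_on phase_segment r" "continuous_on phase_segment q" "continuous_on phase_segment d" "continuous_on phase_segment e"
    unfolding d_def e_def r_def q_def
    by (intro continuous_intros continuous_on_pole_tanh continuous_on_pole_inverse; simp)+
  have "\<exists>K1>0. \<forall>x\<in>phase_segment. cmod (- Ln (pole x) - (- Ln (pole 0) + r 0 * q 0 * x + (d 0 * q 0 + r 0 ^ 2 * q 0 ^ 2) * x\<^sup>2 / 2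
       + (e 0 * d 0 * q 0 + 3 * r 0 * d 0 * q 0 ^ 2 + 2 * r 0 ^ 3 * q 0 ^ 3) * x ^ 3 / 6)) \<le> K1 * cmod x ^ 4"
  proof (rule Taylor_on_phase_segment)
    fix x assume x: "x \<in> phase_segment"
    show "((\<lambda>x. - Ln (pole x)) has_field_derivative r x * q x) (at x)"
      unfolding r_def q_def by (rule Ln_pole_deriv[OF x])
    show "((\<lambda>x. r x * q x) has_field_derivative d x * q x + r x ^ 2 * q x ^ 2) (at x)"
      by (rule DERIV_cong, (rule derivative_intros D[OF x])+) (simp add: eval_nat_numeral algebra_simps)
    show "((\<lambda>x. d x * q x + r x ^ 2 * q x ^ 2) has_field_derivative
        e x * d x * q x + 3 * r x * d x * q x ^ 2 + 2 * r x ^ 3 * q x ^ 3) (at x)"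
      by (rule DERIV_cong, (rule derivative_intros D[OF x])+) (simp add: eval_nat_numeral algebra_simps)
    show "((\<lambda>x. e x * d x * q x + 3 * r x * d x * q x ^ 2 + 2 * r x ^ 3 * q x ^ 3) has_field_derivative
        3 * r x * d x ^ 2 * q x + e x ^ 2 * d x * q x + e x * d x * r x * q x ^ 2
        + 3 * d x ^ 2 * q x ^ 2 + 3 * r x * e x * d x * q x ^ 2 + 6 * r x ^ 2 * d x * q x ^ 3
        + 6 * r x ^ 2 * d x * q x ^ 3 + 6 * r x ^ 4 * q x ^ 4) (at x)"
      by (rule DERIV_cong, (rule derivative_intros D[OF x])+) (simp add: eval_nat_numeral algebra_simps)
  next
    show "continuous_on phase_segment (\<lambda>x. 3 * r x * d x ^ 2 * q x + e x ^ 2 * d x * q x + e x * d x * r x * q x ^ 2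
        + 3 * d x ^ 2 * q x ^ 2 + 3 * r x * e x * d x * q x ^ 2 + 6 * r x ^ 2 * d x * q x ^ 3
        + 6 * r x ^ 2 * d x * q x ^ 3 + 6 * r x ^ 4 * q x ^ 4)"
      by (intro continuous_intros cont)
  qed
  then obtain K1 where K1: "0 < K1"
    "\<And>x. x \<in> phase_segment \<Longrightarrow> cmod (- Ln (pole x) - (- Ln (pole 0) + r 0 * q 0 * x + (d 0 * q 0 + r 0 ^ 2 * q 0 ^ 2) * x\<^sup>2 / 2
       + (e 0 * d 0 * q 0 + 3 * r 0 * d 0 * q 0 ^ 2 + 2 * r 0 ^ 3 * q 0 ^ 3) * x ^ 3 / 6)) \<le> K1 * cmod x ^ 4" by blast
  have "\<exists>K2>0. \<forall>x\<in>phase_segment. cmod (- x / 2 - Ln (pole_cosh x) - (- 0 / 2 - Ln (pole_cosh 0) + (r 0 ^ 2 - 1) / 2 * x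
       + r 0 * d 0 * x\<^sup>2 / 2 + (d 0 ^ 2 + r 0 * e 0 * d 0) * x ^ 3 / 6)) \<le> K2 * cmod x ^ 4"
  proof (rule Taylor_on_phase_segment)
    fix x assume x: "x \<in> phase_segment"
    show "((\<lambda>x. - x / 2 - Ln (pole_cosh x)) has_field_derivative (r x ^ 2 - 1) / 2) (at x)"
      unfolding r_def by (rule Ln_pole_cosh_deriv[OF x])
    show "((\<lambda>x. (r x ^ 2 - 1) / 2) has_field_derivative r x * d x) (at x)"
      using D[OF x] by (auto intro!: derivative_eq_intros)
    show "((\<lambda>x. r x * d x) has_field_derivative d x ^ 2 + r x * e x * d x) (at x)"
      by (rule DERIV_cong, (rule derivative_intros D[OF x])+) (simp add: eval_nat_numeral algebra_simps)
    show "((\<lambda>x. d x ^ 2 + r x * e x * d x) has_field_derivative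
        3 * e x * d x ^ 2 + 3 * r x ^ 2 * d x ^ 2 + r x * e x ^ 2 * d x) (at x)"
      by (rule DERIV_cong, (rule derivative_intros D[OF x])+) (simp add: eval_nat_numeral algebra_simps)
  next
    show "continuous_on phase_segment (\<lambda>x. 3 * e x * d x ^ 2 + 3 * r x ^ 2 * d x ^ 2 + r x * e x ^ 2 * d x)"
      by (intro continuous_intros cont)
  qed
  then obtain K2 where K2: "0 < K2"
    "\<And>x. x \<in> phase_segment \<Longrightarrow> cmod (- x / 2 - Ln (pole_cosh x) - (- 0 / 2 - Ln (pole_cosh 0) + (r 0 ^ 2 - 1) / 2 * x
       + r 0 * d 0 * x\<^sup>2 / 2 + (d 0 ^ 2 + r 0 * e 0 * d 0) * x ^ 3 / 6)) \<le> K2 * cmod x ^ 4" by blast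
  define \<rho> where "\<rho> = 1 / sqrt (5::real)"
  have \<rho>: "\<rho>\<^sup>2 = 1 / 5" "\<rho> ^ 3 = \<rho> / 5"
    by (simp_all add: \<rho>_def power_divide power3_eq_cube)
  have r0: "r 0 = of_real \<rho>" by (simp add: r_def pole_tanh_0 \<rho>_def)
  have q0: "q 0 = of_real (1 / omega)" by (simp add: q_def pole_0 inverse_eq_divide)
  have d0: "d 0 = of_real (- 2 / 5 * \<rho>)"
    unfolding d_def r0 by (simp flip: of_real_power add: \<rho>)
  have e0: "e 0 = of_real (- 1 / 5)"
    unfolding e_def r0 by (simp flip: of_real_power add: \<rho>)
  show ?thesis
  proof (rule that[of "K1 + K2"])
    fix n :: nat and x assume x: "x \<in> phase_segment"
    define N where "N = 2 * of_nat n + (1::complex)"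
    have N: "cmod N = 2 * real n + 1"
    proof -
      have "N = of_real (2 * real n + 1)" by (simp add: N_def)
      thus ?thesis by (simp only: norm_of_real)
    qed
    define P1 where "P1 = r 0 * q 0 * x + (d 0 * q 0 + r 0 ^ 2 * q 0 ^ 2) * x\<^sup>2 / 2
       + (e 0 * d 0 * q 0 + 3 * r 0 * d 0 * q 0 ^ 2 + 2 * r 0 ^ 3 * q 0 ^ 3) * x ^ 3 / 6"
    define P2 where "P2 = (r 0 ^ 2 - 1) / 2 * x
       + r 0 * d 0 * x\<^sup>2 / 2 + (d 0 ^ 2 + r 0 * e 0 * d 0) * x ^ 3 / 6"
    have a: "of_real (a' n) = N * (r 0 * q 0) + (r 0 ^ 2 - 1) / 2"
    proof -
      have "a' n = (2 * real n + 1) * (\<rho> * (1 / omega)) + (\<rho>\<^sup>2 - 1) / 2"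
        unfolding \<rho> by (simp add: a'_def \<rho>_def)
      thus ?thesis by (simp add: N_def r0 q0)
    qed
    have b: "of_real (b' n) = N * (d 0 * q 0 + r 0 ^ 2 * q 0 ^ 2) + r 0 * d 0"
    proof -
      have "b' n = (2 * real n + 1) * (- 2 / 5 * \<rho> * (1 / omega) + \<rho>\<^sup>2 * (1 / omega)\<^sup>2) + (- 2 / 5 * \<rho>\<^sup>2)"
        unfolding \<rho> by (simp add: b'_def \<rho>_def power_divide mult_ac)
      thus ?thesis by (simp add: N_def r0 q0 d0 power2_eq_square)
    qed
    have c: "of_real (third_cumulant n) = N * (e 0 * d 0 * q 0 + 3 * r 0 * d 0 * q 0 ^ 2 + 2 * r 0 ^ 3 * q 0 ^ 3)
        + (d 0 ^ 2 + r 0 * e 0 * d 0)"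
    proof -
      have "third_cumulant n = (2 * real n + 1) * (- 1 / 5 * (- 2 / 5 * \<rho>) * (1 / omega)
          + 3 * (- 2 / 5 * \<rho>\<^sup>2) * (1 / omega)\<^sup>2 + 2 * \<rho> ^ 3 * (1 / omega) ^ 3)
          + (4 / 25 * \<rho>\<^sup>2 + (2 / 25) * \<rho>\<^sup>2)"
        unfolding \<rho> by (simp add: third_cumulant_def \<rho>_def power_divide mult_ac)
      also have "\<dots> = (2 * real n + 1) * (- 1 / 5 * (- 2 / 5 * \<rho>) * (1 / omega)
          + 3 * \<rho> * (- 2 / 5 * \<rho>) * (1 / omega)\<^sup>2 + 2 * \<rho> ^ 3 * (1 / omega) ^ 3)
          + ((- 2 / 5 * \<rho>)\<^sup>2 + \<rho> * (- 1 / 5) * (- 2 / 5 * \<rho>))"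
        by (simp add: power2_eq_square)
      finally show ?thesis
        by (simp only: N_def r0 q0 d0 e0) simp
    qed
    have "of_real (a' n) * x + of_real (b' n) * x\<^sup>2 / 2 + of_real (third_cumulant n) * x ^ 3 / 6 = N * P1 + P2"
      unfolding a b c P1_def P2_def by (simp add: algebra_simps add_divide_distrib)
    hence "log_residue n x - log_residue n 0
        - (of_real (a' n) * x + of_real (b' n) * x\<^sup>2 / 2 + of_real (third_cumulant n) * x ^ 3 / 6)
      = N * (- Ln (pole x) - (- Ln (pole 0) + P1)) + (- x / 2 - Ln (pole_cosh x) - (- 0 / 2 - Ln (pole_cosh 0) + P2))"
      by (simp add: log_residue_def N_def algebra_simps)
    also have "cmod \<dots> \<le> (2 * real n + 1) * (K1 * cmod x ^ 4) + K2 * cmod x ^ 4"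
    proof (rule norm_triangle_mono)
      show "cmod (N * (- Ln (pole x) - (- Ln (pole 0) + P1))) \<le> (2 * real n + 1) * (K1 * cmod x ^ 4)"
        unfolding norm_mult N using K1(2)[OF x] by (intro mult_left_mono) (auto simp: P1_def algebra_simps)
      show "cmod (- x / 2 - Ln (pole_cosh x) - (- 0 / 2 - Ln (pole_cosh 0) + P2)) \<le> K2 * cmod x ^ 4"
        using K2(2)[OF x] by (simp add: P2_def algebra_simps)
    qed
    also have "\<dots> \<le> (K1 + K2) * (2 * real n + 2) * cmod x ^ 4"
    proof -
      have "0 \<le> K1 * cmod x ^ 4 + (2 * real n + 1) * (K2 * cmod x ^ 4)"
        using K1(1) K2(1) by simp
      thus ?thesis by (simp add: algebra_simps)
    qed
    finally show "cmod (log_residue n x - log_residue n 0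
        - (of_real (a' n) * x + of_real (b' n) * x\<^sup>2 / 2 + of_real (third_cumulant n) * x ^ 3 / 6))
      \<le> (K1 + K2) * (2 * real n + 2) * cmod x ^ 4" .
  qed (use K1 K2 in auto)
qed

section \<open>Fourier transform of the Edgeworth density\<close>

lemma integrable_gaussian_moment: "integrable lborel (\<lambda>s::real. exp (- s\<^sup>2 / 2) * s ^ k)"
proof -
  have "integrable lborel (\<lambda>s. sqrt (2 * pi) * (std_normal_density s * s ^ k))"
    using integrable_std_normal_moment[of k] by (intro integrable_mult_right)
  thus ?thesis by (simp add: std_normal_density_def)
qed

lemma integrable_gaussian_iexp:
  "integrable lborel (\<lambda>s::real. complex_of_real (exp (- s\<^sup>2 / 2) * s ^ k) * iexp (- (x * s)))"
proof (rule Bochner_Integration.integrable_bound)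
  show "integrable lborel (\<lambda>s::real. exp (- s\<^sup>2 / 2) * s ^ k)" by (rule integrable_gaussian_moment)
qed (auto simp: norm_mult norm_power abs_mult power_abs)

lemma integral_gaussian_iexp:
  "(CLBINT s. complex_of_real (exp (- s\<^sup>2 / 2)) * iexp (- (x * s)))
     = of_real (sqrt (2 * pi) * exp (- x\<^sup>2 / 2))"
proof -
  have "char std_normal_distribution (- x) = (CLBINT s. std_normal_density s *\<^sub>R iexp (- x * s))"
    unfolding char_def by (intro integral_density) (auto intro!: borel_measurable_continuous_onI continuous_intros)
  also have "\<dots> = (CLBINT s. of_real (1 / sqrt (2 * pi)) * (complex_of_real (exp (- s\<^sup>2 / 2)) * iexp (- (x * s))))"
    by (intro Bochner_Integration.integral_cong refl) (simp add: std_normal_density_def scaleR_conv_of_real)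
  also have "\<dots> = of_real (1 / sqrt (2 * pi)) * (CLBINT s. complex_of_real (exp (- s\<^sup>2 / 2)) * iexp (- (x * s)))"
    by (rule integral_mult_right_zero)
  finally have "of_real (1 / sqrt (2 * pi)) * (CLBINT s. complex_of_real (exp (- s\<^sup>2 / 2)) * iexp (- (x * s)))
      = complex_of_real (exp (- x\<^sup>2 / 2))"
    by (simp add: char_std_normal_distribution)
  thus ?thesis by (simp add: field_simps)
qed

text \<open>For \<open>E(s) = exp (-s\<^sup>2/2 - ixs)\<close> the function \<open>(i (x\<^sup>3 - 3x) - s\<^sup>3) E(s)\<close> is the derivative of
  \<open>(s\<^sup>2 - ixs + 2 - x\<^sup>2) E(s)\<close>, which vanishes at both ends of the real line. So the third moment is a
  multiple of the transform of the Gaussian itself, and the Hermite polynomial \<open>x\<^sup>3 - 3x\<close> appears.\<close>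

lemma integral_gaussian_cubic_iexp:
  "(CLBINT s. complex_of_real (exp (- s\<^sup>2 / 2) * s ^ 3) * iexp (- (x * s)))
     = \<i> * of_real (x ^ 3 - 3 * x) * of_real (sqrt (2 * pi) * exp (- x\<^sup>2 / 2))"
proof -
  define E where "E = (\<lambda>s. complex_of_real (exp (- s\<^sup>2 / 2)) * iexp (- (x * s)))"
  define F where "F = (\<lambda>s. (of_real (s\<^sup>2) - \<i> * of_real (x * s) + of_real (2 - x\<^sup>2)) * E s)"
  define f where "f = (\<lambda>s. (\<i> * of_real (x ^ 3 - 3 * x) - of_real (s ^ 3)) * E s)"
  have E: "(E has_vector_derivative (- of_real s - \<i> * of_real x) * E s) (at s)" for s
    unfolding E_def
    by (auto intro!: derivative_eq_intros simp: has_vector_derivative_complex_iff Re_exp Im_exp algebra_simps)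
  have int_E: "integrable lborel (\<lambda>s. of_real (s ^ k) * E s)" for k
    using integrable_gaussian_iexp[of k x] by (simp add: E_def mult_ac)
  have f_eq: "f = (\<lambda>s. \<i> * of_real (x ^ 3 - 3 * x) * E s - of_real (s ^ 3) * E s)"
    by (simp add: f_def algebra_simps)
  have int_f: "integrable lborel f"
    unfolding f_eq using int_E[of 0] int_E[of 3] by (intro Bochner_Integration.integrable_diff integrable_mult_right) auto
  have decay: "(F \<longlongrightarrow> 0) G" if "((\<lambda>s. s\<^sup>2 * exp (- s\<^sup>2 / 2)) \<longlongrightarrow> 0) G"
    "((\<lambda>s. s * exp (- s\<^sup>2 / 2)) \<longlongrightarrow> 0) G" "((\<lambda>s. exp (- s\<^sup>2 / 2)) \<longlongrightarrow> 0) G" for G :: "real filter"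
  proof -
    have "((\<lambda>s. (of_real (s\<^sup>2 * exp (- s\<^sup>2 / 2)) - \<i> * of_real x * of_real (s * exp (- s\<^sup>2 / 2))
        + of_real (2 - x\<^sup>2) * of_real (exp (- s\<^sup>2 / 2)))) \<longlongrightarrow>
       (of_real 0 - \<i> * of_real x * of_real 0 + of_real (2 - x\<^sup>2) * of_real 0 :: complex)) G"
      by (intro tendsto_intros that)
    hence "((\<lambda>s. norm (of_real (s\<^sup>2 * exp (- s\<^sup>2 / 2)) - \<i> * of_real x * of_real (s * exp (- s\<^sup>2 / 2))
        + of_real (2 - x\<^sup>2) * of_real (exp (- s\<^sup>2 / 2)) :: complex)) \<longlongrightarrow> 0) G"
      by (intro tendsto_norm_zero) simp
    moreover have "norm (F s) = norm (of_real (s\<^sup>2 * exp (- s\<^sup>2 / 2)) - \<i> * of_real x * of_real (s * exp (- s\<^sup>2 / 2))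
        + of_real (2 - x\<^sup>2) * of_real (exp (- s\<^sup>2 / 2)) :: complex)" for s
    proof -
      have "F s = (of_real (s\<^sup>2 * exp (- s\<^sup>2 / 2)) - \<i> * of_real x * of_real (s * exp (- s\<^sup>2 / 2))
        + of_real (2 - x\<^sup>2) * of_real (exp (- s\<^sup>2 / 2))) * iexp (- (x * s))"
        unfolding F_def E_def by (simp add: algebra_simps)
      thus ?thesis by (simp only: norm_mult norm_exp_i_times mult_1_right)
    qed
    ultimately show ?thesis by (intro tendsto_norm_zero_cancel[of F]) simp
  qed
  have "(LBINT s=-\<infinity>..\<infinity>. f s) = 0 - 0"
  proof (rule interval_integral_FTC_integrable)
    fix s :: real
    have D: "((\<lambda>s. of_real (s\<^sup>2) - \<i> * of_real (x * s) + of_real (2 - x\<^sup>2))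
        has_vector_derivative (2 * of_real s - \<i> * of_real x)) (at s)"
    proof -
      have "((\<lambda>z. z\<^sup>2 - \<i> * (of_real x * z) + of_real (2 - x\<^sup>2))
          has_field_derivative 2 * of_real s - \<i> * of_real x) (at (of_real s))"
        by (auto intro!: derivative_eq_intros)
      from has_vector_derivative_real_field[OF this] show ?thesis by simp
    qed
    have "(F has_vector_derivative
        (of_real (s\<^sup>2) - \<i> * of_real (x * s) + of_real (2 - x\<^sup>2)) * ((- of_real s - \<i> * of_real x) * E s)
         + (2 * of_real s - \<i> * of_real x) * E s) (at s)"
      unfolding F_def by (rule has_vector_derivative_mult[OF D E])
    also have "(of_real (s\<^sup>2) - \<i> * of_real (x * s) + of_real (2 - x\<^sup>2)) * ((- of_real s - \<i> * of_real x) * E s)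
         + (2 * of_real s - \<i> * of_real x) * E s = f s"
    proof -
      have "(S^2 - J * (X * S) + (2 - X^2)) * ((- S - J * X) * e) + (2 * S - J * X) * e
         = (J * (X ^ 3 - 3 * X) - S ^ 3) * e + (J * J + 1) * (X ^ 2 * S * e)" for S X J e :: complex
        by (simp add: algebra_simps power2_eq_square power3_eq_cube)
      from this[of "of_real s" \<i> "of_real x" "E s"] show ?thesis by (simp add: f_def)
    qed
    finally show "(F has_vector_derivative f s) (at s)" .
    show "isCont f s" unfolding f_def E_def by (intro continuous_intros) auto
  next
    show "set_integrable lborel (einterval (- \<infinity>) \<infinity>) f"
      using int_f by (simp add: set_integrable_def)
  next
    show "((F \<circ> real_of_ereal) \<longlongrightarrow> 0) (at_right (- \<infinity>))"
      unfolding ereal_tendsto_simps by (rule decay; real_asymp)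
    show "((F \<circ> real_of_ereal) \<longlongrightarrow> 0) (at_left \<infinity>)"
      unfolding ereal_tendsto_simps by (rule decay; real_asymp)
  qed simp
  hence "(CLBINT s. f s) = 0"
    by (simp add: interval_lebesgue_integral_def set_lebesgue_integral_def)
  moreover have "(CLBINT s. f s) = \<i> * of_real (x ^ 3 - 3 * x) * (CLBINT s. E s) - (CLBINT s. of_real (s ^ 3) * E s)"
    unfolding f_eq using int_E[of 0] int_E[of 3]
    by (subst Bochner_Integration.integral_diff) auto
  ultimately have "(CLBINT s. of_real (s ^ 3) * E s) = \<i> * of_real (x ^ 3 - 3 * x) * (CLBINT s. E s)"
    by simp
  thus ?thesis unfolding E_def integral_gaussian_iexp by (simp add: mult_ac)
qed

text \<open>Substituting \<open>s = t \<surd>b\<close> reduces this to the standard Gaussian.\<close>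

lemma gaussian_edgeworth_fourier:
  fixes b k y :: real
  assumes "0 < b"
  defines "x \<equiv> y / sqrt b"
  defines "g \<equiv> (\<lambda>t. complex_of_real (exp (- b * t\<^sup>2 / 2)) * (1 + of_real k * (\<i> * of_real t) ^ 3 / 6) * iexp (- (y * t)))"
  shows "integrable lborel g"
    and "(CLBINT t. g t) = of_real (sqrt (2 * pi) / sqrt b * exp (- x\<^sup>2 / 2) * (1 + k / sqrt b ^ 3 * (x ^ 3 - 3 * x) / 6))"
proof -
  define r where "r = sqrt b"
  have r: "r > 0" "b = r\<^sup>2" "y = r * x" using assms by (simp_all add: r_def)
  define G where "G = (\<lambda>n s. complex_of_real (exp (- s\<^sup>2 / 2) * s ^ n) * iexp (- (x * s)))"
  have G: "integrable lborel (G n)" for n unfolding G_def by (rule integrable_gaussian_iexp)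
  define h where "h = (\<lambda>s. G 0 s - \<i> * of_real (k / r ^ 3 / 6) * G 3 s)"
  have g_eq: "g t = h (0 + r * t)" for t
  proof -
    have "\<i> ^ 3 = - \<i>" by (simp add: power3_eq_cube)
    hence "(\<i> * of_real t) ^ 3 = - \<i> * of_real (t ^ 3)" by (simp add: power_mult_distrib)
    thus ?thesis
      using r \<open>\<i> ^ 3 = - \<i>\<close> by (simp add: g_def h_def G_def power_mult_distrib field_simps)
  qed
  have int_h: "integrable lborel h"
    unfolding h_def by (intro Bochner_Integration.integrable_diff integrable_mult_right G)
  show "integrable lborel g"
    unfolding g_eq[abs_def] using int_h r by (intro lborel_integrable_real_affine) auto
  have "(CLBINT s. h s) = \<bar>r\<bar> *\<^sub>R (CLBINT t. h (0 + r * t))"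
    using r by (intro lborel_integral_real_affine) auto
  hence "(CLBINT t. g t) = (CLBINT s. h s) / of_real r"
    using r by (simp add: g_eq scaleR_conv_of_real)
  also have "(CLBINT s. h s) = (CLBINT s. G 0 s) - \<i> * of_real (k / r ^ 3 / 6) * (CLBINT s. G 3 s)"
    unfolding h_def using G
    by (subst Bochner_Integration.integral_diff) auto
  also have "(CLBINT s. G 0 s) = of_real (sqrt (2 * pi) * exp (- x\<^sup>2 / 2))"
    unfolding G_def using integral_gaussian_iexp[of x] by simp
  also have "(CLBINT s. G 3 s) = \<i> * of_real (x ^ 3 - 3 * x) * of_real (sqrt (2 * pi) * exp (- x\<^sup>2 / 2))"
    unfolding G_def by (rule integral_gaussian_cubic_iexp)
  also have "(of_real (sqrt (2 * pi) * exp (- x\<^sup>2 / 2)) - \<i> * of_real (k / r ^ 3 / 6) *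
      (\<i> * of_real (x ^ 3 - 3 * x) * of_real (sqrt (2 * pi) * exp (- x\<^sup>2 / 2)))) / of_real r
    = complex_of_real (sqrt (2 * pi) / r * exp (- x\<^sup>2 / 2) * (1 + k / r ^ 3 * (x ^ 3 - 3 * x) / 6))"
  proof -
    have "(e - \<i> * K * (\<i> * P * e)) / R = e / R * (1 + K * P)" for e K P R :: complex
      by (simp add: add_divide_distrib algebra_simps)
    from this[of "of_real (sqrt (2 * pi) * exp (- x\<^sup>2 / 2))" "of_real (k / r ^ 3 / 6)" "of_real (x ^ 3 - 3 * x)" "of_real r"]
    show ?thesis by simp
  qed
  finally show "(CLBINT t. g t) = of_real (sqrt (2 * pi) / sqrt b * exp (- x\<^sup>2 / 2) * (1 + k / sqrt b ^ 3 * (x ^ 3 - 3 * x) / 6))"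
    by (simp only: r_def)
qed

section \<open>The error as a Fourier integral\<close>

text \<open>The generating polynomial, in \<open>z\<close>, of the numbers \<open>(2j)! {n, j} / (2n)!\<close>. Up to a factor it counts
  renewals: \<open>2 \<omega>^(2k) / (2k)!\<close> with \<open>k \<ge> 1\<close> is a probability distribution because \<open>C(\<omega>) = 1\<close>, and
  \<open>\<omega>^(2n) (2j)! {n, j} / (2n)!\<close> is the probability that \<open>j\<close> independent steps add up to \<open>n\<close>.\<close>

definition renewal_gf :: "nat \<Rightarrow> complex \<Rightarrow> complex" where
  "renewal_gf n z = fps_nth (inverse (1 - fps_const z * versine_fps)) (2 * n)"

lemma phase_segmentI: "\<bar>t\<bar> \<le> pi \<Longrightarrow> \<i> * of_real t \<in> phase_segment"
  by (simp add: phase_segment_def)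

lemma renewal_gf_iexp:
  "renewal_gf n (iexp t) = (\<Sum>k\<le>n. fps_nth (versine_fps ^ k) (2 * n) * iexp (real k * t))"
  unfolding renewal_gf_def geometric_fps_nth
  by (intro sum.cong refl) (simp add: mult_ac flip: exp_of_nat_mult)

lemma continuous_renewal_gf: "continuous_on A (\<lambda>t. renewal_gf n (iexp t))"
  unfolding renewal_gf_iexp by (intro continuous_intros)

lemma integral_iexp_period:
  "(CLINT t:{-pi..pi}|lborel. iexp (real_of_int m * t)) = (if m = 0 then of_real (2 * pi) else 0)"
proof (cases "m = 0")
  case True
  have "(CLINT t:{-pi..pi}|lborel. 1) = of_real (2 * pi)"
    by (simp add: set_lebesgue_integral_def scaleR_conv_of_real)
  thus ?thesis using True by simp
next
  case False
  define F where "F = (\<lambda>t. iexp (real_of_int m * t) / (\<i> * of_int m))"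
  have "(CLBINT t=-pi..pi. iexp (real_of_int m * t)) = F pi - F (- pi)"
  proof (rule interval_integral_FTC_finite)
    fix t :: real
    have "((\<lambda>z. exp (c * z) / c) has_field_derivative exp (c * of_real t)) (at (of_real t))"
      if "c \<noteq> 0" for c :: complex
      using that by (auto intro!: derivative_eq_intros)
    from this[of "\<i> * of_int m"] False
    have "((\<lambda>z. exp (\<i> * of_int m * z) / (\<i> * of_int m)) has_field_derivative
        exp (\<i> * of_int m * of_real t)) (at (of_real t))" by simp
    from has_vector_derivative_real_field[OF this]
    show "(F has_vector_derivative iexp (real_of_int m * t)) (at t within {min (- pi) pi..max (- pi) pi})"
      by (simp add: F_def mult.assoc)
  qed (intro continuous_intros)
  moreover have "F pi = F (- pi)"
  proof -
    have "iexp (real_of_int m * pi) = iexp (real_of_int m * - pi)"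
      unfolding exp_eq by (rule exI[of _ m]) (simp add: algebra_simps)
    thus ?thesis by (simp only: F_def)
  qed
  ultimately show ?thesis
    using False by (simp add: interval_integral_Icc)
qed

text \<open>For \<open>j < 0\<close> and for \<open>j > n\<close> the integral vanishes by orthogonality, in agreement with the value \<open>0\<close>
  of \<open>fact_cheb_stirling\<close>.\<close>

lemma fact_cheb_stirling_Fourier:
  "(CLINT t:{-pi..pi}|lborel. renewal_gf n (iexp t) * iexp (- (real_of_int j * t)))
     = of_real (2 * pi * (fact_cheb_stirling n j / fact (2 * n)))"
proof -
  define q where "q = (\<lambda>k. fps_nth (versine_fps ^ k) (2 * n))"
  have "(CLINT t:{-pi..pi}|lborel. renewal_gf n (iexp t) * iexp (- (real_of_int j * t)))
      = (CLINT t:{-pi..pi}|lborel. (\<Sum>k\<le>n. q k * iexp (real_of_int (int k - j) * t)))"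
    unfolding renewal_gf_iexp q_def sum_distrib_right
    by (intro arg_cong2[where f = "set_lebesgue_integral _"] ext sum.cong refl)
       (simp add: algebra_simps exp_diff exp_minus divide_inverse)
  also have "\<dots> = (\<Sum>k\<le>n. (CLINT t:{-pi..pi}|lborel. q k * iexp (real_of_int (int k - j) * t)))"
    unfolding set_lebesgue_integral_def scaleR_sum_right
    by (intro Bochner_Integration.integral_sum borel_integrable_atLeastAtMost'[unfolded set_integrable_def]
        continuous_intros)
  also have "\<dots> = (\<Sum>k\<le>n. if int k = j then q k * of_real (2 * pi) else 0)"
  proof (intro sum.cong refl)
    fix k
    have "(CLINT t:{-pi..pi}|lborel. q k * iexp (real_of_int (int k - j) * t))
        = q k * (CLINT t:{-pi..pi}|lborel. iexp (real_of_int (int k - j) * t))"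
      unfolding set_lebesgue_integral_def mult_scaleR_right[symmetric] by (rule integral_mult_right_zero)
    also have "(CLINT t:{-pi..pi}|lborel. iexp (real_of_int (int k - j) * t))
        = (if int k = j then of_real (2 * pi) else 0)"
      using integral_iexp_period[of "int k - j"] by (simp only: right_minus_eq)
    also have "q k * (if int k = j then of_real (2 * pi) else 0) = (if int k = j then q k * of_real (2 * pi) else 0)"
      by simp
    finally show "(CLINT t:{-pi..pi}|lborel. q k * iexp (real_of_int (int k - j) * t))
        = (if int k = j then q k * of_real (2 * pi) else 0)" .
  qed
  also have "\<dots> = of_real (2 * pi * (fact_cheb_stirling n j / fact (2 * n)))"
  proof (cases "0 \<le> j \<and> j \<le> int n")
    case True
    hence "(\<Sum>k\<le>n. if int k = j then q k * of_real (2 * pi) else 0)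
        = (\<Sum>k\<in>{nat j}. q k * of_real (2 * pi))"
      by (intro sum.mono_neutral_cong_right) auto
    also have "\<dots> = of_real (2 * pi * (fact_cheb_stirling n j / fact (2 * n)))"
      using True by (simp add: q_def cheb_stirling_conv_fps_nth fact_cheb_stirling_def)
    finally show ?thesis .
  next
    case False
    hence "(\<Sum>k\<le>n. if int k = j then q k * of_real (2 * pi) else 0) = 0"
      by (intro sum.neutral) auto
    moreover have "fact_cheb_stirling n j = 0"
      using False by (auto simp: fact_cheb_stirling_def cheb_stirling_eq_0)
    ultimately show ?thesis by simp
  qed
  finally show ?thesis .
qed

lemma c'_eq:
  assumes "n > 0" "b' n > 0"
  shows "c' n / sqrt (real n) = third_cumulant n / sqrt (b' n) ^ 3"
proof -
  define \<rho> where "\<rho> = sqrt (5::real)"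
  have \<rho>: "\<rho> > 0" "\<rho> * \<rho> = 5" by (simp_all add: \<rho>_def)
  have "2 / (25 * \<rho> * omega) = 2 * \<rho> / (125 * omega)" "2 / (5 * \<rho> * omega ^ 3) = 2 * \<rho> / (25 * omega ^ 3)"
    using \<rho> omega_pos by (simp_all add: field_simps)
  hence "third_cumulant n = (2 * real n + 1) * (2 * \<rho> / (125 * omega) - 6 / (25 * omega\<^sup>2) + 2 * \<rho> / (25 * omega ^ 3)) + 6 / 125"
    by (simp only: third_cumulant_def \<rho>_def)
  also have "\<dots> = 2 / (5 * omega) ^ 3 *
     ((2 * \<rho> * omega^2 - 30 * omega + 10 * \<rho>) * real n
       + 3 * omega^3 + \<rho> * omega^2 - 15 * omega + 5 * \<rho>)"
    using omega_pos by (simp add: field_simps power2_eq_square power3_eq_cube)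
  finally show ?thesis
    using assms by (simp add: c'_def \<rho>_def power_mult_distrib)
qed

text \<open>The reciprocal of the residue term \<open>2v / (s w^(2n+1))\<close> at \<open>\<tau> = 0\<close>.\<close>

definition normalization :: "nat \<Rightarrow> real" where
  "normalization n = sqrt 5 * omega ^ (2 * n + 1) / 2"

text \<open>The difference between the Fourier transforms, centred at \<open>a'\<close>, of the normalized numbers (supported
  on one period) and of the Edgeworth density (supported on the real line).\<close>

definition Fourier_error :: "nat \<Rightarrow> real \<Rightarrow> complex" where
  "Fourier_error n t =
     indicator {-pi..pi} t *\<^sub>R (of_real (normalization n) * renewal_gf n (iexp t) * iexp (- (a' n * t)))
     - of_real (exp (- b' n * t\<^sup>2 / 2)) * (1 + of_real (third_cumulant n) * (\<i> * of_real t) ^ 3 / 6)"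

lemma lhs_minus_edgeworth:
  assumes "n > 0" "b' n > 0"
  shows "integrable lborel (\<lambda>t. Fourier_error n t * iexp (- ((real_of_int j - a' n) * t)))"
    and "of_real (lhs_term n j - edgeworth_term n j)
      = of_real (sqrt (b' n) / (2 * pi)) * (CLBINT t. Fourier_error n t * iexp (- ((real_of_int j - a' n) * t)))"
proof -
  define y where "y = real_of_int j - a' n"
  define x where "x = x_std n j"
  define N where "N = normalization n"
  define g where "g = (\<lambda>t. complex_of_real (exp (- b' n * t\<^sup>2 / 2)) * (1 + of_real (third_cumulant n) * (\<i> * of_real t) ^ 3 / 6) * iexp (- (y * t)))"
  define h where "h = (\<lambda>t. indicator {-pi..pi} t *\<^sub>R (renewal_gf n (iexp t) * iexp (- (real_of_int j * t))))"
  have x: "x = y / sqrt (b' n)" by (simp add: x_def x_std_def y_def)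
  have "integrable lborel g"
    unfolding g_def by (rule gaussian_edgeworth_fourier[OF assms(2)])
  moreover have "integrable lborel h"
    unfolding h_def
    by (intro borel_integrable_atLeastAtMost'[unfolded set_integrable_def] continuous_intros continuous_renewal_gf)
  moreover have eq: "(\<lambda>t. Fourier_error n t * iexp (- (y * t))) = (\<lambda>t. of_real N * h t - g t)"
  proof
    fix t
    have "iexp (- (a' n * t)) * iexp (- (y * t)) = iexp (- (real_of_int j * t))"
      by (simp add: y_def algebra_simps flip: exp_add)
    hence "indicator {-pi..pi} t *\<^sub>R (of_real N * renewal_gf n (iexp t) * iexp (- (a' n * t))) * iexp (- (y * t)) = of_real N * h t"
      by (simp add: h_def mult_ac)
    thus "Fourier_error n t * iexp (- (y * t)) = of_real N * h t - g t"
      by (simp only: Fourier_error_def g_def left_diff_distrib N_def)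
  qed
  ultimately show int: "integrable lborel (\<lambda>t. Fourier_error n t * iexp (- ((real_of_int j - a' n) * t)))"
    unfolding y_def[symmetric] by simp
  have "(CLBINT t. Fourier_error n t * iexp (- (y * t))) = of_real N * (CLBINT t. h t) - (CLBINT t. g t)"
    unfolding eq using \<open>integrable lborel g\<close> \<open>integrable lborel h\<close>
    by (subst Bochner_Integration.integral_diff) auto
  also have "(CLBINT t. h t) = of_real (2 * pi * (fact_cheb_stirling n j / fact (2 * n)))"
    using fact_cheb_stirling_Fourier[of n j] by (simp add: h_def set_lebesgue_integral_def)
  also have "(CLBINT t. g t) = of_real (sqrt (2 * pi) / sqrt (b' n) * exp (- x\<^sup>2 / 2)
      * (1 + third_cumulant n / sqrt (b' n) ^ 3 * (x ^ 3 - 3 * x) / 6))"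
    unfolding g_def x by (rule gaussian_edgeworth_fourier[OF assms(2)])
  finally have "of_real (sqrt (b' n) / (2 * pi)) * (CLBINT t. Fourier_error n t * iexp (- (y * t)))
    = of_real (sqrt (b' n) / (2 * pi) * (N * (2 * pi * (fact_cheb_stirling n j / fact (2 * n)))
        - sqrt (2 * pi) / sqrt (b' n) * exp (- x\<^sup>2 / 2)
      * (1 + third_cumulant n / sqrt (b' n) ^ 3 * (x ^ 3 - 3 * x) / 6)))"
    by (simp only: of_real_mult of_real_diff)
  moreover have "lhs_term n j = sqrt (b' n) / (2 * pi) * (N * (2 * pi * (fact_cheb_stirling n j / fact (2 * n))))"
    by (simp add: lhs_term_def N_def normalization_def real_sqrt_mult)
  moreover have "edgeworth_term n j = sqrt (b' n) / (2 * pi) * (sqrt (2 * pi) / sqrt (b' n) * exp (- x\<^sup>2 / 2)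
      * (1 + third_cumulant n / sqrt (b' n) ^ 3 * (x ^ 3 - 3 * x) / 6))"
  proof -
    have "sqrt (2 * pi) * sqrt (2 * pi) = 2 * pi" by simp
    hence "1 / sqrt (2 * pi) = sqrt (b' n) / (2 * pi) * (sqrt (2 * pi) / sqrt (b' n))"
      using assms by (simp add: field_simps)
    thus ?thesis
      unfolding edgeworth_term_def Let_def x_def[symmetric] c'_eq[OF assms, symmetric]
      by (simp add: mult.assoc)
  qed
  ultimately show "of_real (lhs_term n j - edgeworth_term n j)
      = of_real (sqrt (b' n) / (2 * pi)) * (CLBINT t. Fourier_error n t * iexp (- ((real_of_int j - a' n) * t)))"
    unfolding y_def[symmetric] by (simp only: right_diff_distrib)
qed

lemma exp_log_residue:
  assumes "\<tau> \<in> phase_segment"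
  shows "exp (log_residue n \<tau>) = 2 * pole_sinh \<tau> / (pole_cosh \<tau> * pole \<tau> ^ (2 * n + 1))"
proof -
  define w where "w = pole \<tau>"
  have w: "w \<noteq> 0" using pole_nz[OF assms] by (simp add: w_def)
  have "exp ((2 * of_nat n + 1) * (- Ln w)) = exp (of_nat (2 * n + 1) * (- Ln w))"
    by (rule arg_cong[where f = exp]) simp
  also have "\<dots> = exp (- Ln w) ^ (2 * n + 1)" by (rule exp_of_nat_mult)
  also have "exp (- Ln w) = inverse w" using w by (simp add: exp_minus)
  finally have 1: "exp ((2 * of_nat n + 1) * (- Ln w)) = inverse w ^ (2 * n + 1)" .
  have 2: "exp (- \<tau> / 2 - Ln (pole_cosh \<tau>)) = 2 * pole_sinh \<tau> / pole_cosh \<tau>"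
    using pole_cosh_nz[OF assms] by (simp add: exp_diff pole_sinh_def)
  show ?thesis
    unfolding log_residue_def exp_add 1[unfolded w_def] 2
    by (simp add: field_simps)
qed

lemma normalization_mult_exp_log_residue_0:
  "of_real (normalization n) * exp (log_residue n 0) = 1"
proof -
  have "2 * pole_sinh 0 / (pole_cosh 0 * pole 0 ^ (2 * n + 1)) = 2 * pole_tanh 0 / pole 0 ^ (2 * n + 1)"
    by (simp add: pole_tanh_def)
  also have "\<dots> = of_real (2 / (sqrt 5 * omega ^ (2 * n + 1)))"
    unfolding pole_tanh_0 pole_0 by simp
  finally have "2 * pole_sinh 0 / (pole_cosh 0 * pole 0 ^ (2 * n + 1)) = of_real (2 / (sqrt 5 * omega ^ (2 * n + 1)))" .
  thus ?thesis
    unfolding exp_log_residue[OF zero_in_phase_segment] normalization_def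
    using omega_pos by (simp flip: of_real_mult)
qed

text \<open>The factor \<open>1 + exp (Re \<delta>)\<close> bounds the exponential on the half-plane \<open>Re z \<le> max 0 (Re \<delta>)\<close>, which
  contains \<open>0\<close> and \<open>\<delta>\<close>.\<close>

lemma norm_exp_minus_linear:
  "cmod (exp \<delta> - 1 - \<delta>) \<le> (cmod \<delta>)\<^sup>2 * (1 + exp (Re \<delta>))"
proof -
  define S where "S = {z. Re z \<le> max 0 (Re \<delta>)}"
  have "cmod (exp \<delta> - (\<Sum>i\<le>1. exp 0 * (\<delta> - 0) ^ i / fact i)) \<le> (1 + exp (Re \<delta>)) * cmod (\<delta> - 0) ^ Suc 1 / fact 1"
  proof (rule field_Taylor[where S = S and f = "\<lambda>_. exp"])
    show "convex S" unfolding S_def by (rule convex_halfspace_Re_le)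
    show "cmod (exp z) \<le> 1 + exp (Re \<delta>)" if "z \<in> S" for z
    proof -
      have "exp (Re z) \<le> exp (max 0 (Re \<delta>))" using that by (simp add: S_def)
      also have "\<dots> \<le> 1 + exp (Re \<delta>)" by (simp add: max_def)
      finally show ?thesis by simp
    qed
  next
    show "0 \<in> S" "\<delta> \<in> S" by (simp_all add: S_def)
  next
    show "(exp has_field_derivative exp z) (at z within S)" for z
      by (rule has_field_derivative_at_within, rule DERIV_exp)
  qed
  thus ?thesis by (simp add: power2_eq_square mult_ac diff_diff_eq)
qed

section \<open>Estimating the error\<close>

lemma affine_le_linear:
  fixes p q :: real
  assumes "n \<ge> (1::nat)"
  shows "\<bar>p * (2 * real n + 1) + q\<bar> \<le> (3 * \<bar>p\<bar> + \<bar>q\<bar>) * real n"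
proof -
  have "\<bar>p * (2 * real n + 1) + q\<bar> \<le> \<bar>p\<bar> * (2 * real n + 1) + \<bar>q\<bar>"
    using abs_triangle_ineq[of "p * (2 * real n + 1)" q] by (simp add: abs_mult)
  also have "\<dots> \<le> \<bar>p\<bar> * (3 * real n) + \<bar>q\<bar> * real n"
    using assms by (intro add_mono mult_left_mono) (auto simp: mult_le_cancel_left1)
  finally show ?thesis by (simp add: algebra_simps)
qed

text \<open>The slope of \<open>b'\<close> is positive because \<open>2\<omega> < \<surd>5\<close>; its negative constant term makes the lower
  bound hold only from some \<open>N\<close> on.\<close>

lemma b'_and_third_cumulant_linear:
  obtains \<beta> \<gamma> N where "0 < \<beta>" "0 < \<gamma>" "1 \<le> N"
    "\<And>n. n \<ge> N \<Longrightarrow> \<beta> * real n \<le> b' n" "\<And>n. n \<ge> N \<Longrightarrow> b' n \<le> \<gamma> * real n"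
    "\<And>n. n \<ge> N \<Longrightarrow> \<bar>third_cumulant n\<bar> \<le> \<gamma> * real n"
proof -
  define p where "p = 1 / (5 * omega^2) - 2 / (5 * sqrt 5 * omega)"
  define k where "k = 2 / (25 * sqrt 5 * omega) - 6 / (25 * omega\<^sup>2) + 2 / (5 * sqrt 5 * omega ^ 3)"
  have p: "0 < p"
  proof -
    have "2 * omega < sqrt 5" using sqrt_5_gt omega_less_1 by simp
    hence "2 * omega * (5 * omega) < sqrt 5 * (5 * omega)" using omega_pos by (intro mult_strict_right_mono) auto
    thus ?thesis using omega_pos by (simp add: p_def field_simps power2_eq_square)
  qed
  define N where "N = nat \<lceil>1 / p\<rceil> + 1"
  define \<gamma> where "\<gamma> = (3 * \<bar>p\<bar> + \<bar>- 2 / 25\<bar>) + (3 * \<bar>k\<bar> + \<bar>6 / 125\<bar>)"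
  show thesis
  proof (rule that[of p \<gamma> N])
    fix n assume n: "n \<ge> N"
    hence n1: "n \<ge> 1" by (simp add: N_def)
    have "1 / p \<le> real n" using n unfolding N_def by linarith
    hence pn: "1 \<le> p * real n" using p by (simp add: field_simps)
    have b: "b' n = p * (2 * real n + 1) + (- 2 / 25)"
      by (simp add: b'_def p_def)
    have "p * (2 * real n + 1) = p * real n + p * real n + p" by (simp add: algebra_simps)
    thus "p * real n \<le> b' n" unfolding b using pn p by linarith
    have "b' n \<le> (3 * \<bar>p\<bar> + \<bar>- 2 / 25\<bar>) * real n"
      using affine_le_linear[OF n1, of p "- 2 / 25"] unfolding b by linarith
    also have "\<dots> \<le> \<gamma> * real n" unfolding \<gamma>_def by (intro mult_right_mono) auto
    finally show "b' n \<le> \<gamma> * real n" .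
    have "\<bar>third_cumulant n\<bar> \<le> (3 * \<bar>k\<bar> + \<bar>6 / 125\<bar>) * real n"
      using affine_le_linear[OF n1, of k "6 / 125"] by (simp add: third_cumulant_def k_def mult.commute)
    also have "\<dots> \<le> \<gamma> * real n" unfolding \<gamma>_def by (intro mult_right_mono) auto
    finally show "\<bar>third_cumulant n\<bar> \<le> \<gamma> * real n" .
  qed (use p in \<open>auto simp: N_def \<gamma>_def\<close>)
qed

lemma norm_normalized_residue_le:
  obtains c where "0 < c"
    "\<And>n t. \<bar>t\<bar> \<le> pi \<Longrightarrow> cmod (exp (log_residue n (\<i> * of_real t) - log_residue n 0)) \<le> 2 * exp (- c * real n * t\<^sup>2)"
proof -
  obtain c where c: "0 < c" "\<And>\<tau>. \<tau> \<in> phase_segment \<Longrightarrow> omega * exp (c * (Im \<tau>)^2) \<le> cmod (pole \<tau>)"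
    using norm_pole_gaussian_lower_bound by blast
  show thesis
  proof (rule that[OF c(1)])
    fix n :: nat and t :: real assume "\<bar>t\<bar> \<le> pi"
    define \<tau> where "\<tau> = \<i> * complex_of_real t"
    have \<tau>: "\<tau> \<in> phase_segment" unfolding \<tau>_def by (rule phase_segmentI[OF \<open>\<bar>t\<bar> \<le> pi\<close>])
    define W where "W = cmod (pole \<tau>)"
    have W: "0 < W" using pole_nz[OF \<tau>] by (simp add: W_def)
    have le: "omega / W \<le> exp (- c * t\<^sup>2)"
      using c(2)[OF \<tau>] W by (simp add: \<tau>_def W_def exp_minus field_simps)
    have "(3 / 4)\<^sup>2 \<le> (cmod (pole_cosh \<tau>))\<^sup>2"
      using norm_pole_cosh[OF \<tau>] by (simp add: power2_eq_square)
    hence s: "3 / 4 \<le> cmod (pole_cosh \<tau>)" by (rule power2_le_imp_le) simp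
    have "exp (log_residue n \<tau> - log_residue n 0) = of_real (normalization n) * exp (log_residue n \<tau>)"
      using normalization_mult_exp_log_residue_0[of n] by (simp add: exp_diff field_simps)
    hence "cmod (exp (log_residue n \<tau> - log_residue n 0)) = normalization n * (1 / (cmod (pole_cosh \<tau>) * W ^ (2 * n + 1)))"
      using omega_pos by (simp add: exp_log_residue[OF \<tau>] norm_mult norm_divide norm_power W_def
          norm_pole_sinh[OF \<tau>] normalization_def)
    also have "\<dots> = (sqrt 5 / 2 / cmod (pole_cosh \<tau>)) * (omega / W) ^ (2 * n + 1)"
      by (simp add: normalization_def power_divide)
    also have "\<dots> \<le> 2 * exp (- c * t\<^sup>2) ^ (2 * n + 1)"
    proof (intro mult_mono power_mono le)
      have "sqrt 5 / 2 \<le> 2 * (3 / 4)" using sqrt_5_less by simp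
      also have "\<dots> \<le> 2 * cmod (pole_cosh \<tau>)" using s by simp
      finally show "sqrt 5 / 2 / cmod (pole_cosh \<tau>) \<le> 2"
        using s by (subst pos_divide_le_eq) auto
    qed (use omega_pos W in auto)
    also have "exp (- c * t\<^sup>2) ^ (2 * n + 1) = exp (real (2 * n + 1) * (- c * t\<^sup>2))"
      by (rule exp_of_nat_mult[symmetric])
    also have "\<dots> \<le> exp (- c * real n * t\<^sup>2)"
    proof -
      have "0 \<le> (real n + 1) * (c * t\<^sup>2)" using c(1) by simp
      thus ?thesis by (simp add: algebra_simps)
    qed
    finally show "cmod (exp (log_residue n (\<i> * of_real t) - log_residue n 0)) \<le> 2 * exp (- c * real n * t\<^sup>2)"
      by (simp add: \<tau>_def)
  qed
qed

text \<open>On the period, write the normalized residue term as \<open>exp A\<close> and the Gaussian as \<open>exp P\<close>. Then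
  \<open>\<delta> = A - P\<close> is the cubic term \<open>T\<close> plus a remainder \<open>E = O(n t^4)\<close>, and
  \<open>exp A - exp P (1 + T) = exp P (exp \<delta> - 1 - \<delta>) + exp P E\<close>. As \<open>\<delta> = O(n |t|\<^sup>3)\<close>, and as both
  \<open>exp P\<close> and \<open>exp A\<close> have Gaussian decay, this is \<open>O((n\<^sup>2 t^6 + n t^4) exp (-c n t\<^sup>2))\<close>. Outside the
  period only the Gaussian part is left, and \<open>|t| \<ge> 1\<close> allows it to be absorbed into the same bound.\<close>

lemma norm_Fourier_error_le:
  obtains C c N where "0 < C" "0 < c" "1 \<le> N"
    "\<And>n t. n \<ge> N \<Longrightarrow> cmod (Fourier_error n t)
       \<le> C * ((real n)\<^sup>2 * t ^ 6 + real n * t ^ 4) * exp (- c * real n * t\<^sup>2) + C * (1 / 9) ^ n * indicator {-pi..pi} t"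
proof -
  obtain \<beta> \<gamma> N where lin: "0 < \<beta>" "0 < \<gamma>" "1 \<le> N"
    "\<And>n. n \<ge> N \<Longrightarrow> \<beta> * real n \<le> b' n" "\<And>n. n \<ge> N \<Longrightarrow> b' n \<le> \<gamma> * real n"
    "\<And>n. n \<ge> N \<Longrightarrow> \<bar>third_cumulant n\<bar> \<le> \<gamma> * real n"
    using b'_and_third_cumulant_linear by blast
  obtain c where c: "0 < c"
    "\<And>n t. \<bar>t\<bar> \<le> pi \<Longrightarrow> cmod (exp (log_residue n (\<i> * of_real t) - log_residue n 0)) \<le> 2 * exp (- c * real n * t\<^sup>2)"
    using norm_normalized_residue_le by blast
  obtain K where K: "0 < K"
    "\<And>n \<tau>. \<tau> \<in> phase_segment \<Longrightarrow> cmod (log_residue n \<tau> - log_residue n 0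
        - (of_real (a' n) * \<tau> + of_real (b' n) * \<tau>\<^sup>2 / 2 + of_real (third_cumulant n) * \<tau> ^ 3 / 6))
      \<le> K * (2 * real n + 2) * cmod \<tau> ^ 4"
    using log_residue_Taylor by blast
  obtain B where B: "0 < B"
    "\<And>\<tau> n. \<tau> \<in> phase_segment \<Longrightarrow>
       cmod (fps_nth (inverse (1 - fps_const (exp \<tau>) * versine_fps)) (2 * n)
              - 2 * pole_sinh \<tau> / (pole_cosh \<tau> * pole \<tau> ^ (2 * n + 1))) \<le> B * (1 / 9) ^ n"
    using geometric_fps_nth_asymptotics by blast
  define m where "m = min c (\<beta> / 2)"
  have m: "0 < m" "m \<le> c" "m \<le> \<beta> / 2" using c(1) lin(1) by (auto simp: m_def)
  \<comment> \<open>With \<open>|t| \<le> pi < 4\<close> the remainder \<open>4 K n t^4\<close> is at most \<open>16 K n |t|\<^sup>3\<close>, so \<open>|\<delta>| \<le> M n |t|\<^sup>3\<close>.\<close>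
  define M where "M = \<gamma> + 16 * K"
  define C where "C = 3 * M\<^sup>2 + 4 * K + 1 + \<gamma> + 2 * B"
  have pos: "0 \<le> 3 * M\<^sup>2" "0 < 4 * K" "0 < \<gamma>" "0 < 2 * B" using lin(2) K(1) B(1) by auto
  have C: "0 < C" "3 * M\<^sup>2 \<le> C" "4 * K \<le> C" "1 + \<gamma> \<le> C" "2 * B \<le> C"
    using pos unfolding C_def by linarith+
  have main: "cmod (Fourier_error n t)
       \<le> C * ((real n)\<^sup>2 * t ^ 6 + real n * t ^ 4) * exp (- m * real n * t\<^sup>2) + C * (1 / 9) ^ n * indicator {-pi..pi} t"
    if n: "n \<ge> N" for n t
  proof -
    have n1: "real n \<ge> 1" using n lin(3) by simp
    define G where "G = exp (- m * real n * t\<^sup>2)"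
    define k where "k = third_cumulant n"
    define P where "P = - b' n * t\<^sup>2 / 2"
    define T where "T = of_real k * (\<i> * complex_of_real t) ^ 3 / 6"
    have k: "\<bar>k\<bar> \<le> \<gamma> * real n" unfolding k_def by (rule lin(6)[OF n])
    have P: "exp P \<le> G"
    proof -
      have "m * real n \<le> \<beta> / 2 * real n" using m n1 by (intro mult_right_mono) auto
      also have "\<dots> \<le> b' n / 2" using lin(4)[OF n] by simp
      finally have "m * real n * t\<^sup>2 \<le> b' n / 2 * t\<^sup>2" by (intro mult_right_mono) auto
      thus ?thesis by (simp add: G_def P_def)
    qed
    have T_le: "cmod T \<le> \<gamma> * (real n * \<bar>t\<bar> ^ 3)"
    proof -
      have "cmod T = \<bar>k\<bar> * \<bar>t\<bar> ^ 3 / 6"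
        by (simp add: T_def norm_mult norm_power norm_divide)
      also have "\<dots> \<le> \<bar>k\<bar> * \<bar>t\<bar> ^ 3" by simp
      also have "\<dots> \<le> (\<gamma> * real n) * \<bar>t\<bar> ^ 3" using k by (intro mult_right_mono) auto
      finally show ?thesis by (simp add: mult_ac)
    qed
    have even: "\<bar>t\<bar> ^ 4 = t ^ 4" "\<bar>t\<bar> ^ 6 = t ^ 6" by simp_all
    show ?thesis
    proof (cases "\<bar>t\<bar> \<le> pi")
      case False
      hence ind: "indicator {-pi..pi} t = (0::real)" by (auto simp: indicator_def abs_le_iff)
      have t1: "1 \<le> \<bar>t\<bar>" using False pi_gt3 by linarith
      have "1 * 1 \<le> real n * \<bar>t\<bar> ^ 4" using n1 t1 by (intro mult_mono one_le_power) auto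
      moreover have "\<gamma> * (real n * \<bar>t\<bar> ^ 3) \<le> \<gamma> * (real n * \<bar>t\<bar> ^ 4)"
        using pos t1 by (intro mult_left_mono power_increasing) auto
      ultimately have "1 + cmod T \<le> (1 + \<gamma>) * (real n * \<bar>t\<bar> ^ 4)"
        using T_le by (simp add: algebra_simps)
      also have "\<dots> \<le> C * ((real n)\<^sup>2 * t ^ 6 + real n * t ^ 4)"
        using C pos unfolding even by (intro mult_mono) auto
      finally have "cmod (1 + T) \<le> C * ((real n)\<^sup>2 * t ^ 6 + real n * t ^ 4)"
        using norm_triangle_ineq[of 1 T] by simp
      hence "exp P * cmod (1 + T) \<le> G * (C * ((real n)\<^sup>2 * t ^ 6 + real n * t ^ 4))"
        using P by (intro mult_mono) (auto simp: G_def)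
      moreover have "cmod (Fourier_error n t) = exp P * cmod (1 + T)"
      proof -
        have "Fourier_error n t = - (of_real (exp P) * (1 + T))"
          by (simp add: Fourier_error_def P_def T_def k_def ind)
        thus ?thesis by (simp add: norm_mult)
      qed
      ultimately show ?thesis by (simp add: ind G_def mult_ac)
    next
      case True
      define \<tau> where "\<tau> = \<i> * complex_of_real t"
      have \<tau>: "\<tau> \<in> phase_segment" unfolding \<tau>_def by (rule phase_segmentI[OF True])
      have ind: "indicator {-pi..pi} t = (1::real)" using True by (auto simp: indicator_def abs_le_iff)
      define A where "A = log_residue n \<tau> - log_residue n 0 - of_real (a' n) * \<tau>"
      define \<delta> where "\<delta> = A - of_real P"
      define E where "E = \<delta> - T"
      have expA: "exp A = exp (log_residue n \<tau> - log_residue n 0) * iexp (- (a' n * t))"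
        by (simp add: A_def \<tau>_def algebra_simps flip: exp_add)
      have "cmod (exp A) \<le> 2 * exp (- c * real n * t\<^sup>2)"
        unfolding expA norm_mult using c(2)[OF True, of n] by (simp add: \<tau>_def)
      also have "\<dots> \<le> 2 * G"
        using m n1 by (auto simp: G_def intro!: mult_right_mono)
      finally have A: "cmod (exp A) \<le> 2 * G" .
      have E: "cmod E \<le> 4 * K * (real n * t ^ 4)"
      proof -
        have "E = log_residue n \<tau> - log_residue n 0
          - (of_real (a' n) * \<tau> + of_real (b' n) * \<tau>\<^sup>2 / 2 + of_real (third_cumulant n) * \<tau> ^ 3 / 6)"
          by (simp add: E_def \<delta>_def A_def P_def T_def k_def \<tau>_def power_mult_distrib)
        hence "cmod E \<le> K * (2 * real n + 2) * cmod \<tau> ^ 4" using K(2)[OF \<tau>] by simp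
        also have "\<dots> = K * (2 * real n + 2) * t ^ 4" by (simp add: \<tau>_def norm_mult)
        also have "\<dots> \<le> K * (4 * real n) * t ^ 4"
          using K(1) n1 by (intro mult_right_mono mult_left_mono) auto
        finally show ?thesis by (simp add: mult_ac)
      qed
      have "cmod \<delta> \<le> M * (real n * \<bar>t\<bar> ^ 3)"
      proof -
        have "cmod \<delta> \<le> cmod T + cmod E" using norm_triangle_ineq[of T E] by (simp add: E_def)
        also have "t ^ 4 = \<bar>t\<bar> * \<bar>t\<bar> ^ 3" using power_add[of "\<bar>t\<bar>" 1 3] even(1) by simp
        hence "cmod T + cmod E \<le> \<gamma> * (real n * \<bar>t\<bar> ^ 3) + 4 * K * (real n * (\<bar>t\<bar> * \<bar>t\<bar> ^ 3))"
          using T_le E by simp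
        also have "\<dots> \<le> \<gamma> * (real n * \<bar>t\<bar> ^ 3) + 4 * K * (real n * (4 * \<bar>t\<bar> ^ 3))"
          using True pi_less_4 K(1) by (intro add_left_mono mult_left_mono mult_right_mono) auto
        finally show ?thesis by (simp add: M_def algebra_simps)
      qed
      hence "(cmod \<delta>)\<^sup>2 \<le> (M * (real n * \<bar>t\<bar> ^ 3))\<^sup>2" by (intro power_mono) auto
      also have "\<dots> = M\<^sup>2 * ((real n)\<^sup>2 * t ^ 6)"
      proof -
        have "(\<bar>t\<bar> ^ 3)\<^sup>2 = t ^ 6"
          using power_mult[of "\<bar>t\<bar>" 3 2] even(2) by simp
        thus ?thesis by (simp only: power_mult_distrib)
      qed
      finally have \<delta>: "(cmod \<delta>)\<^sup>2 \<le> M\<^sup>2 * ((real n)\<^sup>2 * t ^ 6)" .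
      have "exp A - of_real (exp P) * (1 + T) = of_real (exp P) * (exp \<delta> - 1 - \<delta>) + of_real (exp P) * E"
      proof -
        have "exp A = of_real (exp P) * exp \<delta>"
          by (simp add: \<delta>_def exp_diff exp_of_real)
        thus ?thesis by (simp add: E_def algebra_simps)
      qed
      hence "cmod (exp A - of_real (exp P) * (1 + T)) \<le> exp P * cmod (exp \<delta> - 1 - \<delta>) + exp P * cmod E"
        using norm_triangle_ineq[of "of_real (exp P) * (exp \<delta> - 1 - \<delta>)" "of_real (exp P) * E"]
        by (simp add: norm_mult)
      also have "exp P * cmod (exp \<delta> - 1 - \<delta>) \<le> exp P * ((cmod \<delta>)\<^sup>2 * (1 + exp (Re \<delta>)))"
        by (intro mult_left_mono norm_exp_minus_linear) auto
      \<comment> \<open>Multiplying by \<open>exp P\<close> turns \<open>exp (Re \<delta>)\<close> into \<open>|exp A|\<close>, so a possibly large \<open>\<delta>\<close> is harmless.\<close>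
      also have "\<dots> = (cmod \<delta>)\<^sup>2 * (exp P + cmod (exp A))"
        by (simp add: \<delta>_def exp_diff field_simps)
      also have "\<dots> \<le> (M\<^sup>2 * ((real n)\<^sup>2 * t ^ 6)) * (3 * G)"
        using \<delta> A P by (intro mult_mono) auto
      also have "exp P * cmod E \<le> G * (4 * K * (real n * t ^ 4))"
        using P E by (intro mult_mono) (auto simp: G_def)
      also have "M\<^sup>2 * ((real n)\<^sup>2 * t ^ 6) * (3 * G) + G * (4 * K * (real n * t ^ 4))
         = (3 * M\<^sup>2) * ((real n)\<^sup>2 * t ^ 6 * G) + (4 * K) * (real n * t ^ 4 * G)"
        by (simp add: mult_ac)
      also have "\<dots> \<le> C * ((real n)\<^sup>2 * t ^ 6 * G) + C * (real n * t ^ 4 * G)"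
        using C by (intro add_mono mult_right_mono) (auto simp: G_def)
      finally have 1: "cmod (exp A - of_real (exp P) * (1 + T)) \<le> C * ((real n)\<^sup>2 * t ^ 6 * G) + C * (real n * t ^ 4 * G)"
        by simp
      define R where "R = of_real (normalization n) * renewal_gf n (iexp t) * iexp (- (a' n * t)) - exp A"
      have 2: "cmod R \<le> C * (1 / 9) ^ n"
      proof -
        have "R = of_real (normalization n) * (renewal_gf n (exp \<tau>) - exp (log_residue n \<tau>)) * iexp (- (a' n * t))"
        proof -
          have "exp (log_residue n \<tau> - log_residue n 0) = of_real (normalization n) * exp (log_residue n \<tau>)"
            using normalization_mult_exp_log_residue_0[of n] by (simp add: exp_diff field_simps)
          thus ?thesis unfolding R_def expA by (simp add: \<tau>_def algebra_simps)
        qed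
        hence "cmod R = \<bar>normalization n\<bar> * cmod (renewal_gf n (exp \<tau>) - exp (log_residue n \<tau>))"
          by (simp add: norm_mult)
        also have "\<dots> \<le> 2 * (B * (1 / 9) ^ n)"
        proof (intro mult_mono)
          show "cmod (renewal_gf n (exp \<tau>) - exp (log_residue n \<tau>)) \<le> B * (1 / 9) ^ n"
            unfolding renewal_gf_def exp_log_residue[OF \<tau>] by (rule B(2)[OF \<tau>])
          have "omega ^ (2 * n + 1) \<le> 1" using omega_pos omega_less_1 by (intro power_le_one) auto
          hence "sqrt 5 * omega ^ (2 * n + 1) \<le> 4 * 1"
            using sqrt_5_less omega_pos by (intro mult_mono) auto
          thus "\<bar>normalization n\<bar> \<le> 2" using omega_pos by (simp add: normalization_def abs_mult)
        qed auto
        also have "\<dots> \<le> C * (1 / 9) ^ n" using C(5) mult_right_mono[of "2 * B" C "(1 / 9) ^ n"] by simp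
        finally show ?thesis .
      qed
      have "Fourier_error n t = (exp A - of_real (exp P) * (1 + T)) + R"
        by (simp add: Fourier_error_def R_def P_def T_def k_def ind)
      hence "cmod (Fourier_error n t) \<le> (C * ((real n)\<^sup>2 * t ^ 6 * G) + C * (real n * t ^ 4 * G)) + C * (1 / 9) ^ n"
        using norm_triangle_ineq[of "exp A - of_real (exp P) * (1 + T)" R] 1 2 by simp
      thus ?thesis by (simp add: ind G_def algebra_simps)
    qed
  qed
  show thesis by (rule that[OF C(1) m(1) lin(3)]) (rule main)
qed

text \<open>Half of the exponential decay absorbs the polynomial, via \<open>y / k \<le> exp (y / k)\<close> for \<open>k = 2, 3\<close>.\<close>

lemma cubic_mult_exp_le:
  fixes u c :: real
  assumes "0 \<le> u" "0 < c"
  shows "(u ^ 3 + u\<^sup>2) * exp (- c * u) \<le> (27 * (2 / c) ^ 3 + 4 * (2 / c)\<^sup>2) * exp (- (c / 2) * u)"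
proof -
  define y where "y = c * u / 2"
  have y: "0 \<le> y" "u = (2 / c) * y" using assms by (simp_all add: y_def)
  have "y / 3 \<le> exp (y / 3)" "y / 2 \<le> exp (y / 2)"
    using exp_ge_add_one_self[of "y / 3"] exp_ge_add_one_self[of "y / 2"] by linarith+
  hence "(y / 3) ^ 3 \<le> exp (y / 3) ^ 3" "(y / 2) ^ 2 \<le> exp (y / 2) ^ 2"
    using y by (intro power_mono; simp)+
  hence "y ^ 3 \<le> 27 * exp y" "y\<^sup>2 \<le> 4 * exp y"
    by (simp_all add: power_divide flip: exp_of_nat_mult)
  hence "(2 / c) ^ 3 * y ^ 3 + (2 / c)\<^sup>2 * y\<^sup>2 \<le> (2 / c) ^ 3 * (27 * exp y) + (2 / c)\<^sup>2 * (4 * exp y)"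
    using assms by (intro add_mono mult_left_mono) auto
  moreover have "u ^ 3 + u\<^sup>2 = (2 / c) ^ 3 * y ^ 3 + (2 / c)\<^sup>2 * y\<^sup>2"
    by (simp only: y(2) power_mult_distrib)
  ultimately have "u ^ 3 + u\<^sup>2 \<le> (27 * (2 / c) ^ 3 + 4 * (2 / c)\<^sup>2) * exp y"
    by (simp only: distrib_left distrib_right mult_ac)
  hence "(u ^ 3 + u\<^sup>2) * exp (- c * u) \<le> (27 * (2 / c) ^ 3 + 4 * (2 / c)\<^sup>2) * exp y * exp (- c * u)"
    by (intro mult_right_mono) auto
  also have "\<dots> = (27 * (2 / c) ^ 3 + 4 * (2 / c)\<^sup>2) * exp (- (c / 2) * u)"
    by (simp add: y_def mult.assoc flip: exp_add)
  finally show ?thesis .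
qed

lemma integral_gaussian:
  assumes "0 < (b::real)"
  shows "integrable lborel (\<lambda>t. exp (- b * t\<^sup>2 / 2))"
    and "(LBINT t. exp (- b * t\<^sup>2 / 2)) = sqrt (2 * pi) / sqrt b"
proof -
  have "integrable lborel (\<lambda>t. complex_of_real (exp (- b * t\<^sup>2 / 2)))"
    using gaussian_edgeworth_fourier(1)[OF assms, of 0 0] by simp
  thus "integrable lborel (\<lambda>t. exp (- b * t\<^sup>2 / 2))"
    by (subst (asm) complex_of_real_integrable_eq)
  have "complex_of_real (LBINT t. exp (- b * t\<^sup>2 / 2)) = of_real (sqrt (2 * pi) / sqrt b)"
    using gaussian_edgeworth_fourier(2)[OF assms, of 0 0]
    unfolding integral_complex_of_real[symmetric] by simp
  thus "(LBINT t. exp (- b * t\<^sup>2 / 2)) = sqrt (2 * pi) / sqrt b"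
    by (simp only: of_real_eq_iff)
qed

text \<open>In terms of \<open>u = n t\<^sup>2\<close> the bound for the Fourier error is \<open>(u\<^sup>3 + u\<^sup>2) exp (-cu) / n\<close>, so its
  integral over \<open>t\<close> is of order \<open>n^(-3/2)\<close>; the prefactor \<open>sqrt b'\<close> and the weight \<open>sqrt n\<close>
  contribute a factor of order \<open>n\<close>.\<close>

lemma lhs_minus_edgeworth_le:
  obtains C N where "0 < C" "1 \<le> N"
    "\<And>n j. n \<ge> N \<Longrightarrow> \<bar>lhs_term n j - edgeworth_term n j\<bar> * sqrt (real n)
        \<le> C * (1 / sqrt (real n) + real n * (1 / 9) ^ n)"
proof -
  obtain \<beta> \<gamma> N1 where lin: "0 < \<beta>" "0 < \<gamma>" "1 \<le> N1"
    "\<And>n. n \<ge> N1 \<Longrightarrow> \<beta> * real n \<le> b' n" "\<And>n. n \<ge> N1 \<Longrightarrow> b' n \<le> \<gamma> * real n"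
    "\<And>n. n \<ge> N1 \<Longrightarrow> \<bar>third_cumulant n\<bar> \<le> \<gamma> * real n"
    using b'_and_third_cumulant_linear by blast
  obtain C c N2 where err: "0 < C" "0 < c" "1 \<le> N2"
    "\<And>n t. n \<ge> N2 \<Longrightarrow> cmod (Fourier_error n t)
       \<le> C * ((real n)\<^sup>2 * t ^ 6 + real n * t ^ 4) * exp (- c * real n * t\<^sup>2) + C * (1 / 9) ^ n * indicator {-pi..pi} t"
    using norm_Fourier_error_le by blast
  define C1 where "C1 = C * (27 * (2 / c) ^ 3 + 4 * (2 / c)\<^sup>2)"
  define Q where "Q = C1 * (sqrt (2 * pi) / sqrt c) + C * (2 * pi)"
  have C1: "0 < C1" using err by (simp add: C1_def add_pos_pos)
  have Q: "C1 * (sqrt (2 * pi) / sqrt c) \<le> Q" "C * (2 * pi) \<le> Q" "0 < Q"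
    using C1 err by (simp_all add: Q_def add_pos_pos)
  have main: "\<bar>lhs_term n j - edgeworth_term n j\<bar> * sqrt (real n)
        \<le> sqrt \<gamma> / (2 * pi) * Q * (1 / sqrt (real n) + real n * (1 / 9) ^ n)"
    if n: "n \<ge> max N1 N2" for n j
  proof -
    have n1: "real n \<ge> 1" "n \<ge> N1" "n \<ge> N2" using n lin(3) by auto
    have n0: "n > 0" using n1 by simp
    have "0 < \<beta> * real n" using lin(1) n1 by simp
    hence b: "0 < b' n" "b' n \<le> \<gamma> * real n" using lin(4,5)[OF n1(2)] by linarith+
    define g where "g = (\<lambda>t. C1 / real n * exp (- (c * real n) * t\<^sup>2 / 2) + C * (1 / 9) ^ n * indicator {-pi..pi} t)"
    have bound: "cmod (Fourier_error n t * iexp (- ((real_of_int j - a' n) * t))) \<le> g t" for t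
    proof -
      define u where "u = real n * t\<^sup>2"
      have u: "0 \<le> u" by (simp add: u_def)
      have "C * ((real n)\<^sup>2 * t ^ 6 + real n * t ^ 4) * exp (- c * real n * t\<^sup>2)
          = C / real n * ((u ^ 3 + u\<^sup>2) * exp (- c * u))"
        using n1 by (simp add: u_def power_mult_distrib field_simps eval_nat_numeral)
      also have "\<dots> \<le> C / real n * ((27 * (2 / c) ^ 3 + 4 * (2 / c)\<^sup>2) * exp (- (c / 2) * u))"
        using err n1 u by (intro mult_left_mono cubic_mult_exp_le) auto
      also have "\<dots> = C1 / real n * exp (- (c * real n) * t\<^sup>2 / 2)"
        by (simp add: C1_def u_def)
      finally have "C * ((real n)\<^sup>2 * t ^ 6 + real n * t ^ 4) * exp (- c * real n * t\<^sup>2)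
          \<le> C1 / real n * exp (- (c * real n) * t\<^sup>2 / 2)" .
      thus ?thesis using err(4)[OF n1(3), of t] by (simp add: g_def norm_mult)
    qed
    have cn: "0 < c * real n" using err n1 by simp
    have int1: "integrable lborel (\<lambda>t. C1 / real n * exp (- (c * real n) * t\<^sup>2 / 2))"
      by (intro integrable_mult_right integral_gaussian cn)
    have int2: "integrable lborel (\<lambda>t. C * (1 / 9) ^ n * indicator {-pi..pi} t :: real)"
      by (intro integrable_mult_right) auto
    have int_g: "integrable lborel g"
      unfolding g_def by (intro Bochner_Integration.integrable_add int1 int2)
    have "(LBINT t. g t) = C1 / real n * (sqrt (2 * pi) / sqrt (c * real n)) + C * (1 / 9) ^ n * (2 * pi)"
      unfolding g_def Bochner_Integration.integral_add[OF int1 int2] integral_mult_right_zero integral_gaussian(2)[OF cn]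
      by simp
    also have "\<dots> = 1 / (real n * sqrt (real n)) * (C1 * (sqrt (2 * pi) / sqrt c)) + (1 / 9) ^ n * (C * (2 * pi))"
      by (simp add: real_sqrt_mult)
    also have "\<dots> \<le> 1 / (real n * sqrt (real n)) * Q + (1 / 9) ^ n * Q"
      using Q by (intro add_mono mult_left_mono) auto
    finally have g: "(LBINT t. g t) \<le> Q * (1 / (real n * sqrt (real n)) + (1 / 9) ^ n)"
      by (simp add: algebra_simps)
    have "\<bar>lhs_term n j - edgeworth_term n j\<bar> = cmod (of_real (lhs_term n j - edgeworth_term n j))"
      by (simp only: norm_of_real)
    also have "\<dots> = sqrt (b' n) / (2 * pi) * cmod (CLBINT t. Fourier_error n t * iexp (- ((real_of_int j - a' n) * t)))"
      unfolding lhs_minus_edgeworth(2)[OF n0 b(1)] norm_mult norm_of_real using b by simp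
    also have "\<dots> \<le> sqrt (\<gamma> * real n) / (2 * pi) * (Q * (1 / (real n * sqrt (real n)) + (1 / 9) ^ n))"
    proof (intro mult_mono divide_right_mono)
      have "cmod (CLBINT t. Fourier_error n t * iexp (- ((real_of_int j - a' n) * t))) \<le> (LBINT t. g t)"
        by (rule Bochner_Integration.integral_norm_bound_integral[OF lhs_minus_edgeworth(1)[OF n0 b(1)] int_g])
           (rule bound)
      thus "cmod (CLBINT t. Fourier_error n t * iexp (- ((real_of_int j - a' n) * t))) \<le> Q * (1 / (real n * sqrt (real n)) + (1 / 9) ^ n)"
        using g by linarith
    qed (use b lin in auto)
    finally have "\<bar>lhs_term n j - edgeworth_term n j\<bar> * sqrt (real n)
      \<le> sqrt (\<gamma> * real n) / (2 * pi) * (Q * (1 / (real n * sqrt (real n)) + (1 / 9) ^ n)) * sqrt (real n)"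
      by (intro mult_right_mono) auto
    also have "\<dots> = sqrt \<gamma> / (2 * pi) * Q * ((sqrt (real n) * sqrt (real n)) * (1 / (real n * sqrt (real n)) + (1 / 9) ^ n))"
      by (simp only: real_sqrt_mult) (simp only: times_divide_eq_left times_divide_eq_right mult_ac)
    also have "(sqrt (real n) * sqrt (real n)) * (1 / (real n * sqrt (real n)) + (1 / 9) ^ n) = 1 / sqrt (real n) + real n * (1 / 9) ^ n"
      using n1 by (simp add: distrib_left)
    finally show ?thesis .
  qed
  show thesis
  proof (rule that[of "sqrt \<gamma> / (2 * pi) * Q" "max N1 N2"])
    show "0 < sqrt \<gamma> / (2 * pi) * Q" using Q lin by simp
    show "1 \<le> max N1 N2" using lin(3) by simp
  qed (rule main)
qed

theorem theorem6p2:
  shows "(\<lambda>n. SUP j::int. ereal (\<bar>lhs_term n j - edgeworth_term n j\<bar> * sqrt (real n)))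
           \<longlonglongrightarrow> 0"
proof -
  obtain C N where C: "0 < C" "1 \<le> N"
    "\<And>n j. n \<ge> N \<Longrightarrow> \<bar>lhs_term n j - edgeworth_term n j\<bar> * sqrt (real n)
        \<le> C * (1 / sqrt (real n) + real n * (1 / 9) ^ n)"
    using lhs_minus_edgeworth_le by blast
  show ?thesis
  proof (rule tendsto_sandwich)
    show "eventually (\<lambda>n. 0 \<le> (SUP j::int. ereal (\<bar>lhs_term n j - edgeworth_term n j\<bar> * sqrt (real n)))) sequentially"
      by (intro always_eventually allI SUP_upper2[of 0]) auto
    show "eventually (\<lambda>n. (SUP j::int. ereal (\<bar>lhs_term n j - edgeworth_term n j\<bar> * sqrt (real n)))
        \<le> ereal (C * (1 / sqrt (real n) + real n * (1 / 9) ^ n))) sequentially"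
      using eventually_ge_at_top[of N] by eventually_elim (intro SUP_least, simp only: ereal_less_eq, rule C(3))
    have "(\<lambda>n. 1 / sqrt (real n) + real n * (1 / 9) ^ n) \<longlonglongrightarrow> 0" by real_asymp
    hence "(\<lambda>n. C * (1 / sqrt (real n) + real n * (1 / 9) ^ n)) \<longlonglongrightarrow> C * 0" by (rule tendsto_mult_left)
    thus "(\<lambda>n. ereal (C * (1 / sqrt (real n) + real n * (1 / 9) ^ n))) \<longlonglongrightarrow> 0"
      by (simp add: zero_ereal_def)
  qed simp
qed

end
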